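(* For each $n$ let $\boldsymbol d=\boldsymbol d^{(n)}=(d_1,\dots,d_n)$ be a sequence of positive integers with even sum. Suppose that $d_{\max}=\max_{i\in[n]}d_i=o(\sqrt n)$ and $\nu_n\to\infty$ as $n\to\infty$. Then, for the configuration model $\mathrm{CM}_n(\boldsymbol d)$, $$\frac{M_n-\lambda_n^{M}}{\sqrt{\lambda_n^{M}}}\ \xrightarrow{\ d\ }\ Z\qquad(n\to\infty),$$ where $Z$ is a standard normal random variable.
   Context: Configuration model: given positive integers $\boldsymbol d=(d_1,\dots,d_n)$ with even sum $\ell_n=\sum_{i\in[n]}d_i$, where $[n]=\{1,\dots,n\}$, attach $d_i$ half-edges to vertex $i$ for each $i\in[n]$, and match the $\ell_n$ half-edges in pairs uniformly at random; each pair forms an edge. The resulting random multigraph on $[n]$ is $\mathrm{CM}_n(\boldsymbol d)$. For $i\neq j\in[n]$, $X_{ij}$ is the number of edges between $i$ and $j$. Define $$M_n=\sum_{1\le i<j\le n}\binom{X_{ij}}{2},\qquad \lambda_n^{M}=\mathbb E[M_n],\qquad \nu_n=\frac{\sum_{i\in[n]}d_i(d_i-1)}{\ell_n}.$$ $\xrightarrow{d}$ denotes convergence in distribution. *)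

theory Defs
  imports "HOL-Probability.Probability" "HOL-Library.Landau_Symbols"
begin

text \<open>
  A half-edge is a pair \<open>(i, k)\<close>: the \<open>k\<close>-th half-edge attached to vertex \<open>i\<close>.
  Vertices are \<open>1, \<dots>, n\<close>; values of a degree sequence outside this range are irrelevant.
\<close>

definition half_edges :: "nat \<Rightarrow> (nat \<Rightarrow> nat) \<Rightarrow> (nat \<times> nat) set" where
  "half_edges n d = (SIGMA i:{1..n}. {..<d i})"

definition perfect_matchings :: "'a set \<Rightarrow> 'a set set set" where
  "perfect_matchings H = {P. partition_on H P \<and> (\<forall>e\<in>P. card e = 2)}"

text \<open>
  A multigraph is given by its multiset of edges, an edge being the set of its end points;
  thus a loop at \<open>i\<close> is \<open>{i}\<close>.
\<close>

definition matching_multigraph :: "(nat \<times> nat) set set \<Rightarrow> nat set multiset" where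
  "matching_multigraph P = image_mset (\<lambda>e. fst ` e) (mset_set P)"

text \<open>
  Meaningful if the sum of the degrees is even: otherwise there is no perfect matching, and
  \<^const>\<open>pmf_of_set\<close> of the empty set is unspecified.
\<close>

definition config_model :: "nat \<Rightarrow> (nat \<Rightarrow> nat) \<Rightarrow> nat set multiset pmf" where
  "config_model n d =
     map_pmf matching_multigraph (pmf_of_set (perfect_matchings (half_edges n d)))"

definition edge_count :: "nat set multiset \<Rightarrow> nat \<Rightarrow> nat \<Rightarrow> nat" where
  "edge_count G i j = count G {i, j}"

definition multi_edge_count :: "nat \<Rightarrow> nat set multiset \<Rightarrow> nat" where
  "multi_edge_count n G = (\<Sum>j\<in>{1..n}. \<Sum>i\<in>{1..<j}. edge_count G i j choose 2)"

definition mean_multi_edge_count :: "nat \<Rightarrow> (nat \<Rightarrow> nat) \<Rightarrow> real" where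
  "mean_multi_edge_count n d =
     measure_pmf.expectation (config_model n d) (\<lambda>G. real (multi_edge_count n G))"

definition nu :: "nat \<Rightarrow> (nat \<Rightarrow> nat) \<Rightarrow> real" where
  "nu n d = (\<Sum>i\<in>{1..n}. real (d i) * (real (d i) - 1)) / real (\<Sum>i\<in>{1..n}. d i)"

end

theory Submission
  imports Defs "HOL-Combinatorics.Transposition"
begin

text \<open>
  \<open>M\<close> is the number of pairs \<open>\<alpha>\<close> of parallel edges contained in a uniform perfect matching
  \<open>P\<close> of the half-edges. For fixed \<open>\<alpha>\<close>, two switchings turn \<open>P\<close> into a uniform perfect
  matching containing \<open>\<alpha>\<close> and change \<open>M\<close> by exactly one except with a mean error
  \<open>\<delta> = O(d\<^sub>m\<^sub>a\<^sub>x\<^sup>2 / \<ell>)\<close>. This size-bias coupling shows that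
  \<open>E[M F(M)]\<close> equals \<open>\<lambda> E[F(M + 1)]\<close> up to \<open>\<lambda> \<delta> Lip(F)\<close>.
  Taking for \<open>F\<close> a complex exponential, the characteristic function \<open>\<phi>\<close> of the standardised
  \<open>M\<close> satisfies \<open>\<phi>'(t) + t \<phi>(t) = O(t\<^sup>2 / \<surd>\<lambda> + \<bar>t\<bar> \<delta>)\<close>, hence tends to
  \<open>exp (- t\<^sup>2 / 2)\<close>, because \<open>\<lambda>\<close> is at least of order \<open>\<nu>\<^sup>2\<close>.
\<close>

section \<open>Switchings of perfect matchings\<close>

lemma finite_perfect_matchings: "finite H \<Longrightarrow> finite (perfect_matchings H)"
  unfolding perfect_matchings_def
  by (rule finite_subset[OF _ finitely_many_partition_on]) auto

lemma perfect_matchings_unique_edge: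
  assumes "P \<in> perfect_matchings H" "e \<in> P" "f \<in> P" "x \<in> e" "x \<in> f"
  shows "e = f"
proof -
  have "disjoint P" using assms(1) by (simp add: perfect_matchings_def partition_on_def)
  then show ?thesis using assms by (metis disjointD disjoint_iff)
qed

lemma perfect_matchings_Union: "P \<in> perfect_matchings H \<Longrightarrow> \<Union>P = H"
  unfolding perfect_matchings_def partition_on_def by auto

lemma perfect_matchings_card_edge: "P \<in> perfect_matchings H \<Longrightarrow> e \<in> P \<Longrightarrow> card e = 2"
  unfolding perfect_matchings_def by auto

lemma perfect_matchings_finite_edges:
  "finite H \<Longrightarrow> P \<in> perfect_matchings H \<Longrightarrow> finite P"
  unfolding perfect_matchings_def by (auto intro: finite_elements)

lemma perfect_matchings_edge:
  assumes "P \<in> perfect_matchings H" "{a, b} \<in> P"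
  shows "a \<noteq> b" "a \<in> H" "b \<in> H"
proof -
  show "a \<noteq> b" using perfect_matchings_card_edge[OF assms] by auto
  show "a \<in> H" "b \<in> H" using perfect_matchings_Union[OF assms(1)] assms(2) by auto
qed

text \<open>Match two elements with each other and the rest by induction.\<close>

lemma perfect_matchings_nonempty:
  assumes "finite H" "even (card H)"
  shows "perfect_matchings H \<noteq> {}"
  using assms
proof (induction "card H" arbitrary: H rule: less_induct)
  case less
  show ?case
  proof (cases "H = {}")
    case True
    then have "{} \<in> perfect_matchings H"
      by (simp add: perfect_matchings_def partition_on_def)
    then show ?thesis by blast
  next
    case False
    then obtain a where a: "a \<in> H" by blast
    have "H \<noteq> {a}" using less.prems by auto
    then obtain b where b: "b \<in> H" "b \<noteq> a" using a by blast
    have c: "card (H - {a, b}) = card H - 2"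
      using a b less.prems by (subst card_Diff_subset) auto
    have pos: "card H > 0" using a less.prems by (auto simp: card_gt_0_iff)
    have "perfect_matchings (H - {a, b}) \<noteq> {}"
      using less.prems c pos by (intro less.hyps) auto
    then obtain P where P: "partition_on (H - {a, b}) P" "\<forall>e\<in>P. card e = 2"
      by (auto simp: perfect_matchings_def)
    have "disjnt {a, b} (\<Union>P)" using partition_onD1[OF P(1)] by (auto simp: disjnt_def)
    then have "partition_on H (insert {a, b} P)"
      using P a b by (subst partition_on_insert) auto
    then have "insert {a, b} P \<in> perfect_matchings H"
      using P b by (auto simp: perfect_matchings_def)
    then show ?thesis by blast
  qed
qed

lemma perfect_matchings_image:
  assumes "P \<in> perfect_matchings H" "bij_betw \<pi> H H"
  shows "(`) \<pi> ` P \<in> perfect_matchings H"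
proof -
  have inj: "inj_on \<pi> H" and im: "\<pi> ` H = H" using assms(2) by (auto simp: bij_betw_def)
  have "partition_on H P" using assms(1) by (simp add: perfect_matchings_def)
  then have "partition_on H ((`) \<pi> ` P - {{}})" and ne: "{} \<notin> P"
    using partition_on_inj_image[of H P \<pi>] inj im by (auto simp: partition_on_def)
  moreover have "(`) \<pi> ` P - {{}} = (`) \<pi> ` P" using ne by auto
  moreover have "card (\<pi> ` e) = 2" if "e \<in> P" for e
  proof -
    have "e \<subseteq> H" using that perfect_matchings_Union[OF assms(1)] by auto
    then have "inj_on \<pi> e" using inj by (rule inj_on_subset[rotated])
    then show ?thesis using perfect_matchings_card_edge[OF assms(1) that] by (simp add: card_image)
  qed
  ultimately show ?thesis by (auto simp: perfect_matchings_def)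
qed

section \<open>Partners, and switchings that force a given edge\<close>

definition partner :: "'a set set \<Rightarrow> 'a \<Rightarrow> 'a" where
  "partner P a = (THE b. {a, b} \<in> P)"

lemma partner_eq:
  assumes "P \<in> perfect_matchings H" "{a, b} \<in> P"
  shows "partner P a = b"
  unfolding partner_def
proof (rule the_equality)
  show "{a, b} \<in> P" by fact
  fix c assume "{a, c} \<in> P"
  then have "{a, c} = {a, b}"
    using perfect_matchings_unique_edge[OF assms(1) _ assms(2), of "{a, c}" a] by auto
  then show "c = b" by (auto simp: doubleton_eq_iff)
qed

lemma partner_edge:
  assumes "P \<in> perfect_matchings H" "a \<in> H"
  shows "{a, partner P a} \<in> P"
proof -
  obtain e where e: "e \<in> P" "a \<in> e" using assms perfect_matchings_Union by fastforce
  then obtain b where "e = {a, b}"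
    using perfect_matchings_card_edge[OF assms(1) e(1)] by (auto simp: card_2_iff)
  then show ?thesis using partner_eq[OF assms(1)] e by auto
qed

text \<open>
  Switching forces the edge \<open>{a, b}\<close> into \<open>P\<close>: the edges at \<open>a\<close> and \<open>b\<close> are
  replaced by \<open>{a, b}\<close> and the edge joining the former partners.
\<close>

definition switch :: "'a \<Rightarrow> 'a \<Rightarrow> 'a set set \<Rightarrow> 'a set set" where
  "switch a b P = (`) (Transposition.transpose b (partner P a)) ` P"

lemma bij_betw_transpose_on: "x \<in> H \<Longrightarrow> y \<in> H \<Longrightarrow> bij_betw (Transposition.transpose x y) H H"
  by (intro bij_betw_byWitness[where f' = "Transposition.transpose x y"]) (auto simp: Transposition.transpose_def)

lemma image_transpose_eq_self: "x \<notin> e \<Longrightarrow> y \<notin> e \<Longrightarrow> Transposition.transpose x y ` e = e"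
  by (force simp: Transposition.transpose_def image_iff)

lemma switch_in_perfect_matchings:
  assumes "P \<in> perfect_matchings H" "a \<in> H" "b \<in> H"
  shows "switch a b P \<in> perfect_matchings H"
  unfolding switch_def
  using perfect_matchings_edge(3)[OF assms(1) partner_edge[OF assms(1,2)]] assms
  by (intro perfect_matchings_image bij_betw_transpose_on) auto

text \<open>The transposition carries the partner of \<open>a\<close> to \<open>b\<close>. If that
  partner already is \<open>b\<close>, it is the identity, so this case is covered as well.\<close>

lemma edge_in_switch:
  assumes "P \<in> perfect_matchings H" "a \<in> H" "a \<noteq> b"
  shows "{a, b} \<in> switch a b P"
proof -
  have "a \<noteq> partner P a" using perfect_matchings_edge(1)[OF assms(1) partner_edge[OF assms(1,2)]] .
  then have "Transposition.transpose b (partner P a) ` {a, partner P a} = {a, b}"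
    using assms by (auto simp: Transposition.transpose_def)
  then show ?thesis using partner_edge[OF assms(1,2)] unfolding switch_def by blast
qed

text \<open>An edge that avoids \<open>a\<close> also avoids the partner of \<open>a\<close>, which
  lies only in the edge joining the two. So the transposition fixes every point of the edge.\<close>

lemma untouched_edge_in_switch:
  assumes "P \<in> perfect_matchings H" "a \<in> H" "e \<in> P" "a \<notin> e" "b \<notin> e"
  shows "e \<in> switch a b P"
proof -
  have "partner P a \<notin> e"
    using perfect_matchings_unique_edge[OF assms(1) partner_edge[OF assms(1,2)] assms(3)] assms(4)
    by auto
  then have "Transposition.transpose b (partner P a) ` e = e" using assms by (simp add: image_transpose_eq_self)
  then show ?thesis using assms(3) unfolding switch_def by (metis image_eqI)
qed

text \<open>Transposing \<open>b\<close> and \<open>x\<close> is an involution that exchanges the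
  two sets of matchings. It fixes the edges of \<open>S\<close>, as these avoid both points. The
  case \<open>x = b\<close> is included.\<close>

lemma sum_transpose_matchings:
  assumes "a \<noteq> b" "b \<in> H" "x \<in> H" "a \<noteq> x" "b \<notin> \<Union>S" "x \<notin> \<Union>S"
  shows "(\<Sum>P | P \<in> perfect_matchings H \<and> S \<subseteq> P \<and> {a, x} \<in> P. g ((`) (Transposition.transpose b x) ` P))
       = (\<Sum>Q | Q \<in> perfect_matchings H \<and> S \<subseteq> Q \<and> {a, b} \<in> Q. g Q)"
proof -
  let ?\<tau> = "\<lambda>P. (`) (Transposition.transpose b x) ` P"
  have inv: "?\<tau> (?\<tau> P) = P" for P
    by (simp add: image_image comp_def flip: image_comp)
  have S: "S \<subseteq> ?\<tau> P" if "S \<subseteq> P" for P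
  proof
    fix e assume "e \<in> S"
    then have "Transposition.transpose b x ` e = e" using assms by (intro image_transpose_eq_self) auto
    then show "e \<in> ?\<tau> P" using that \<open>e \<in> S\<close> by (metis image_eqI subsetD)
  qed
  have pm: "?\<tau> P \<in> perfect_matchings H" if "P \<in> perfect_matchings H" for P
    using that assms by (intro perfect_matchings_image bij_betw_transpose_on) auto
  have e1: "Transposition.transpose b x ` {a, x} = {a, b}" and e2: "Transposition.transpose b x ` {a, b} = {a, x}"
    using assms by (auto simp: Transposition.transpose_def)
  have m1: "{a, b} \<in> ?\<tau> P" if "{a, x} \<in> P" for P using that e1 by (metis image_eqI)
  have m2: "{a, x} \<in> ?\<tau> P" if "{a, b} \<in> P" for P using that e2 by (metis image_eqI)
  show ?thesis
    by (rule sum.reindex_bij_witness[where i = ?\<tau> and j = ?\<tau>])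
       (use inv S pm m1 m2 in auto)
qed

text \<open>Sort the matchings by the partner \<open>x\<close> of \<open>a\<close>. On each class
  the switching is the transposition of \<open>b\<close> and \<open>x\<close>, a bijection onto the
  matchings containing \<open>S\<close> and \<open>{a, b}\<close>. So every target has the same
  number of preimages: a uniform matching containing \<open>S\<close> becomes a uniform one that
  also contains \<open>{a, b}\<close>. Taking \<open>g = 1\<close> gives counting results.\<close>

lemma sum_switch:
  fixes g :: "'a set set \<Rightarrow> 'b :: comm_semiring_1"
  assumes H: "finite H" "a \<in> H" "b \<in> H" "a \<noteq> b" and S: "a \<notin> \<Union>S" "b \<notin> \<Union>S" "\<Union>S \<subseteq> H"
  shows "(\<Sum>P | P \<in> perfect_matchings H \<and> S \<subseteq> P. g (switch a b P))
       = of_nat (card H - card (\<Union>S) - 1)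
         * (\<Sum>Q | Q \<in> perfect_matchings H \<and> insert {a, b} S \<subseteq> Q. g Q)"
proof -
  define X where "X = H - \<Union>S - {a}"
  define C where "C x = {P. P \<in> perfect_matchings H \<and> S \<subseteq> P \<and> {a, x} \<in> P}" for x
  have fin: "finite (C x)" for x
    unfolding C_def by (rule finite_subset[OF _ finite_perfect_matchings[OF H(1)]]) auto
  have part: "{P. P \<in> perfect_matchings H \<and> S \<subseteq> P} = (\<Union>x\<in>X. C x)"
  proof safe
    fix P assume P: "P \<in> perfect_matchings H" "S \<subseteq> P"
    have e: "{a, partner P a} \<in> P" by (rule partner_edge[OF P(1) H(2)])
    have "partner P a \<notin> \<Union>S"
    proof
      assume "partner P a \<in> \<Union>S"
      then obtain f where f: "f \<in> S" "partner P a \<in> f" by blast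
      then have "f = {a, partner P a}"
        using perfect_matchings_unique_edge[OF P(1) _ e, of f "partner P a"] P(2) by auto
      then show False using f S by auto
    qed
    then have "partner P a \<in> X" using perfect_matchings_edge[OF P(1) e] by (auto simp: X_def)
    then show "P \<in> (\<Union>x\<in>X. C x)" using P e by (auto simp: C_def)
  qed (auto simp: C_def)
  have disj: "C x \<inter> C y = {}" if "x \<noteq> y" for x y
  proof -
    have "x = partner P a" "y = partner P a" if "P \<in> C x \<inter> C y" for P
      using that partner_eq[of P H a] by (auto simp: C_def)
    then show ?thesis using that by blast
  qed
  \<comment> \<open>The possible partners of \<open>a\<close> are all points off \<open>S\<close>
    except \<open>a\<close> itself; \<open>b\<close> is one of them.\<close>
  have cX: "card X = card H - card (\<Union>S) - 1"
    using H S unfolding X_def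
    by (subst card_Diff_singleton) (auto simp: card_Diff_subset finite_subset)
  have "(\<Sum>P | P \<in> perfect_matchings H \<and> S \<subseteq> P. g (switch a b P)) = (\<Sum>x\<in>X. \<Sum>P\<in>C x. g (switch a b P))"
    unfolding part using fin disj H(1) by (intro sum.UNION_disjoint) (auto simp: X_def)
  also have "\<dots> = (\<Sum>x\<in>X. \<Sum>Q\<in>C b. g Q)"
  proof (rule sum.cong[OF refl])
    fix x assume x: "x \<in> X"
    have "(\<Sum>P\<in>C x. g (switch a b P)) = (\<Sum>P\<in>C x. g ((`) (Transposition.transpose b x) ` P))"
      unfolding switch_def by (intro sum.cong refl) (auto simp: C_def partner_eq)
    also have "\<dots> = (\<Sum>Q\<in>C b. g Q)"
      unfolding C_def using x H S by (intro sum_transpose_matchings) (auto simp: X_def)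
    finally show "(\<Sum>P\<in>C x. g (switch a b P)) = (\<Sum>Q\<in>C b. g Q)" .
  qed
  also have "\<dots> = of_nat (card X) * (\<Sum>Q\<in>C b. g Q)" by simp
  also have "C b = {Q. Q \<in> perfect_matchings H \<and> insert {a, b} S \<subseteq> Q}" by (auto simp: C_def)
  finally show ?thesis by (simp add: cX)
qed

section \<open>Counting the matchings that contain given edges\<close>

definition matchings_containing :: "'a set \<Rightarrow> 'a set set \<Rightarrow> 'a set set set" where
  "matchings_containing H S = {P \<in> perfect_matchings H. S \<subseteq> P}"

lemma finite_matchings_containing: "finite H \<Longrightarrow> finite (matchings_containing H S)"
  by (simp add: matchings_containing_def finite_perfect_matchings)

lemma card_Union_edges:
  assumes "finite S" "P \<in> perfect_matchings H" "S \<subseteq> P"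
  shows "card (\<Union>S) = 2 * card S"
proof -
  have "card (\<Union>S) = (\<Sum>e\<in>S. card e)"
  proof (rule card_Union_disjoint)
    show "pairwise disjnt S"
      using assms perfect_matchings_unique_edge[OF assms(2)]
      unfolding pairwise_def disjnt_def by blast
    show "\<And>e. e \<in> S \<Longrightarrow> finite e"
      using assms perfect_matchings_card_edge[OF assms(2)] by (metis card.infinite subsetD zero_neq_numeral)
  qed
  also have "\<dots> = (\<Sum>e\<in>S. 2)"
    using assms perfect_matchings_card_edge[OF assms(2)] by (intro sum.cong) auto
  finally show ?thesis by simp
qed

text \<open>By \<open>sum_switch\<close> with \<open>g = 1\<close> each further edge costs the
  factor \<open>card H - (2 * i + 1)\<close>, so equality holds if some matching contains
  \<open>S\<close>. Otherwise the left side vanishes, whence the inequality.\<close>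

lemma card_matchings_containing_le:
  assumes H: "finite H" and S: "finite S"
  shows "card (matchings_containing H S) * (\<Prod>i<card S. card H - (2 * i + 1))
           \<le> card (perfect_matchings H)"
  using S
proof (induction S)
  case empty
  then show ?case by (simp add: matchings_containing_def)
next
  case (insert e S)
  show ?case
  proof (cases "matchings_containing H (insert e S) = {}")
    case False
    then obtain P where P: "P \<in> perfect_matchings H" "insert e S \<subseteq> P"
      by (auto simp: matchings_containing_def)
    obtain a b where e: "e = {a, b}" "a \<noteq> b"
      using perfect_matchings_card_edge[OF P(1), of e] P(2) by (auto simp: card_2_iff)
    have ab: "a \<in> H" "b \<in> H" using P e perfect_matchings_edge by (metis insert_subset)+
    have "f = e" if "f \<in> S" "x \<in> f" "x \<in> e" for f x
      using perfect_matchings_unique_edge[OF P(1), of f e x] that P(2) by auto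
    then have nS: "a \<notin> \<Union>S" "b \<notin> \<Union>S" using e insert.hyps by auto
    have SH: "\<Union>S \<subseteq> H" using perfect_matchings_Union[OF P(1)] P(2) by auto
    have cS: "card (\<Union>S) = 2 * card S"
      using P insert.hyps by (intro card_Union_edges) auto
    have "card (matchings_containing H S)
        = (card H - (2 * card S + 1)) * card (matchings_containing H (insert e S))"
      using sum_switch[OF H ab e(2) nS SH, of "\<lambda>_. 1 :: nat"] cS e
      by (simp add: matchings_containing_def)
    then show ?thesis using insert by (simp add: mult_ac)
  qed auto
qed

section \<open>Approximate size bias of the number of contained pairs\<close>

text \<open>The bounds \<open>B1\<close> and \<open>B2\<close> limit the two ways in which pairs
  interact: through a common point and through a common edge. With at least 16 points all factors
  down to \<open>l - 7\<close> are positive.\<close>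

locale edge_pairs =
  fixes H :: "'a set" and A :: "'a set set set" and B1 B2 :: real
  assumes finite_H: "finite H" and even_H: "even (card H)" and large_H: "card H \<ge> 16"
    and finite_A: "finite A"
    and pairs: "\<alpha> \<in> A \<Longrightarrow> \<exists>a b c d. \<alpha> = {{a, b}, {c, d}} \<and> distinct [a, b, c, d] \<and> {a, b, c, d} \<subseteq> H"
    and vertex_bound: "s \<in> H \<Longrightarrow> real (card {\<beta> \<in> A. s \<in> \<Union>\<beta>}) \<le> B1"
    and edge_bound: "real (card {\<beta> \<in> A. e \<in> \<beta>}) \<le> B2"
begin

definition l :: real where "l = real (card H)"

definition N :: real where "N = real (card (perfect_matchings H))"

definition pair_count :: "'a set set \<Rightarrow> nat" where
  "pair_count P = card {\<beta> \<in> A. \<beta> \<subseteq> P}"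

lemma l_ge: "l \<ge> 16" using large_H by (simp add: l_def)

lemma N_pos: "N > 0"
  using perfect_matchings_nonempty[OF finite_H even_H] finite_perfect_matchings[OF finite_H]
  by (simp add: N_def card_gt_0_iff)

lemma card_pair:
  assumes "\<alpha> \<in> A"
  shows "card \<alpha> = 2"
proof -
  obtain a b c d where \<alpha>: "\<alpha> = {{a, b}, {c, d}}" "distinct [a, b, c, d]"
    using pairs[OF assms] by blast
  then have "{a, b} \<noteq> {c, d}" by (auto simp: doubleton_eq_iff)
  then show ?thesis using \<alpha>(1) by simp
qed

lemma finite_pair: "\<alpha> \<in> A \<Longrightarrow> finite \<alpha>"
  using card_pair by (metis card.infinite zero_neq_numeral)

lemma sum_pair_count:
  assumes "finite X"
  shows "(\<Sum>P\<in>X. real (pair_count P)) = (\<Sum>\<beta>\<in>A. real (card {P \<in> X. \<beta> \<subseteq> P}))"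
proof -
  have "(\<Sum>P\<in>X. real (pair_count P)) = (\<Sum>P\<in>X. \<Sum>\<beta>\<in>A. if \<beta> \<subseteq> P then 1 else 0)"
    using finite_A by (simp add: pair_count_def sum.If_cases Int_def)
  also have "\<dots> = (\<Sum>\<beta>\<in>A. \<Sum>P\<in>X. if \<beta> \<subseteq> P then 1 else 0)" by (rule sum.swap)
  also have "\<dots> = (\<Sum>\<beta>\<in>A. real (card {P \<in> X. \<beta> \<subseteq> P}))"
    using assms by (simp add: sum.If_cases Int_def)
  finally show ?thesis .
qed

section \<open>Resampling a matching so that it contains a given pair\<close>

definition resample :: "'a \<Rightarrow> 'a \<Rightarrow> 'a \<Rightarrow> 'a \<Rightarrow> 'a set set \<Rightarrow> 'a set set" where
  "resample a b c d P = switch c d (switch a b P)"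

text \<open>Two applications of \<open>sum_switch\<close>, first with \<open>S = {}\<close> and then
  with \<open>S = {{a, b}}\<close>, contribute one factor each. Hence resampling turns a uniform
  matching into a uniform one among those containing both edges.\<close>

lemma sum_resample:
  fixes g :: "'a set set \<Rightarrow> 'b :: comm_semiring_1"
  assumes "distinct [a, b, c, d]" "{a, b, c, d} \<subseteq> H"
  shows "(\<Sum>P\<in>perfect_matchings H. g (resample a b c d P))
       = of_nat ((card H - 1) * (card H - 3)) * (\<Sum>Q\<in>matchings_containing H {{a, b}, {c, d}}. g Q)"
proof -
  have "(\<Sum>P\<in>perfect_matchings H. g (resample a b c d P))
      = of_nat (card H - 1) * (\<Sum>Q | Q \<in> perfect_matchings H \<and> {{a, b}} \<subseteq> Q. g (switch c d Q))"
    using sum_switch[OF finite_H, of a b "{}" "\<lambda>P. g (switch c d P)"] assms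
    by (simp add: resample_def)
  also have "(\<Sum>Q | Q \<in> perfect_matchings H \<and> {{a, b}} \<subseteq> Q. g (switch c d Q))
      = of_nat (card H - 3) * (\<Sum>Q\<in>matchings_containing H {{a, b}, {c, d}}. g Q)"
  proof -
    have "c \<notin> \<Union>{{a, b}}" "d \<notin> \<Union>{{a, b}}" "\<Union>{{a, b}} \<subseteq> H" "c \<in> H" "d \<in> H" "c \<noteq> d"
      using assms by auto
    moreover have "card H - card (\<Union>{{a, b}}) - 1 = card H - 3" using assms by simp
    moreover have "{Q. Q \<in> perfect_matchings H \<and> insert {c, d} {{a, b}} \<subseteq> Q}
        = matchings_containing H {{a, b}, {c, d}}" by (auto simp: matchings_containing_def)
    ultimately show ?thesis using sum_switch[OF finite_H, of c d "{{a, b}}" g] by simp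
  qed
  finally show ?thesis by (simp add: mult.assoc)
qed

text \<open>The second switching keeps \<open>{a, b}\<close>, because that edge avoids
  \<open>c\<close> and \<open>d\<close>. The last claim limits which pairs resampling can
  destroy.\<close>

lemma resample_properties:
  assumes "distinct [a, b, c, d]" "{a, b, c, d} \<subseteq> H" "P \<in> perfect_matchings H"
  shows "resample a b c d P \<in> perfect_matchings H" "{{a, b}, {c, d}} \<subseteq> resample a b c d P"
    "\<And>e. e \<in> P \<Longrightarrow> e \<inter> {a, b, c, d} = {} \<Longrightarrow> e \<in> resample a b c d P"
proof -
  let ?P = "switch a b P"
  have P: "?P \<in> perfect_matchings H"
    using assms by (intro switch_in_perfect_matchings) auto
  then show "resample a b c d P \<in> perfect_matchings H"
    using assms unfolding resample_def by (intro switch_in_perfect_matchings) auto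
  have "{a, b} \<in> ?P" using assms by (intro edge_in_switch) auto
  then have "{a, b} \<in> resample a b c d P"
    unfolding resample_def
    by (rule untouched_edge_in_switch[OF P, rotated]) (use assms in auto)
  moreover have "{c, d} \<in> resample a b c d P"
    using P assms unfolding resample_def by (intro edge_in_switch) auto
  ultimately show "{{a, b}, {c, d}} \<subseteq> resample a b c d P" by simp
  show "e \<in> resample a b c d P" if "e \<in> P" "e \<inter> {a, b, c, d} = {}" for e
  proof -
    have "e \<in> ?P" by (rule untouched_edge_in_switch[OF assms(3) _ that(1)]) (use that assms in auto)
    then show ?thesis unfolding resample_def
      by (rule untouched_edge_in_switch[OF P, rotated]) (use that assms in auto)
  qed
qed

text \<open>Taking \<open>g = 1\<close> in \<open>sum_resample\<close> counts all matchings. Divided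
  by \<open>N\<close>, this is the probability that a fixed pair is present.\<close>

lemma card_matchings_containing_pair:
  assumes "\<alpha> \<in> A"
  shows "real (card (matchings_containing H \<alpha>)) = N / ((l - 1) * (l - 3))"
proof -
  obtain a b c d where \<alpha>: "\<alpha> = {{a, b}, {c, d}}" "distinct [a, b, c, d]" "{a, b, c, d} \<subseteq> H"
    using pairs[OF assms] by blast
  have "N = (l - 1) * (l - 3) * real (card (matchings_containing H \<alpha>))"
    using sum_resample[OF \<alpha>(2,3), of "\<lambda>_. 1 :: real"] \<alpha>(1) large_H
    by (simp add: N_def l_def of_nat_diff)
  then show ?thesis using l_ge by simp
qed

lemma sum_pair_count_all:
  "(\<Sum>P\<in>perfect_matchings H. real (pair_count P)) = real (card A) * N / ((l - 1) * (l - 3))"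
proof -
  have "(\<Sum>P\<in>perfect_matchings H. real (pair_count P))
      = (\<Sum>\<beta>\<in>A. real (card (matchings_containing H \<beta>)))"
    using sum_pair_count[OF finite_perfect_matchings[OF finite_H]]
    by (simp add: matchings_containing_def)
  also have "\<dots> = (\<Sum>\<beta>\<in>A. N / ((l - 1) * (l - 3)))"
    by (intro sum.cong refl card_matchings_containing_pair)
  finally show ?thesis by simp
qed

text \<open>An upper bound for the mean error of the coupling. The first term bounds twice the mean
  number of lost pairs, the second stems from pairs sharing an edge with the forced pair, and the
  third from the increased probability of the remaining pairs.\<close>

definition defect :: real where
  "defect = 8 * B1 / ((l - 1) * (l - 3)) + 2 * B2 / (l - 5)
     + real (card A) * (1 / ((l - 5) * (l - 7)) - 1 / ((l - 1) * (l - 3)))"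

text \<open>The resampled matching is uniform among those containing \<open>\<alpha>\<close>, so its
  mean count is a sum of conditional probabilities: 1 for \<open>\<alpha>\<close> itself, at most
  \<open>1 / (l - 5)\<close> for a pair sharing one edge with it, and at most
  \<open>1 / ((l - 5) * (l - 7))\<close> for a pair sharing none.\<close>

lemma sum_pair_count_resample_le:
  assumes \<alpha>: "\<alpha> \<in> A" "\<alpha> = {{a, b}, {c, d}}" "distinct [a, b, c, d]" "{a, b, c, d} \<subseteq> H"
  shows "(\<Sum>P\<in>perfect_matchings H. real (pair_count (resample a b c d P)))
       \<le> N * (1 + 2 * B2 / (l - 5) + real (card A) / ((l - 5) * (l - 7)))"
proof -
  \<comment> \<open>\<open>w \<beta> / N\<close> is the conditional probability of
    \<open>\<beta>\<close> given \<open>\<alpha>\<close>.\<close>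
  define w where "w \<beta> = (l - 1) * (l - 3) * real (card (matchings_containing H (\<alpha> \<union> \<beta>)))" for \<beta>
  define A1 where "A1 = {\<beta> \<in> A. {a, b} \<in> \<beta>} \<union> {\<beta> \<in> A. {c, d} \<in> \<beta>}"
  have cA1: "real (card A1) \<le> 2 * B2"
  proof -
    have "real (card A1) \<le> real (card {\<beta> \<in> A. {a, b} \<in> \<beta>}) + real (card {\<beta> \<in> A. {c, d} \<in> \<beta>})"
      unfolding A1_def of_nat_add[symmetric] of_nat_le_iff by (rule card_Un_le)
    then show ?thesis using edge_bound[of "{a, b}"] edge_bound[of "{c, d}"] by linarith
  qed
  have w_self: "w \<alpha> = N" using card_matchings_containing_pair[OF \<alpha>(1)] l_ge by (simp add: w_def)
  have card_un: "card (\<alpha> \<union> \<beta>) + card (\<alpha> \<inter> \<beta>) = 4" if "\<beta> \<in> A" for \<beta>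
    using card_Un_Int[OF finite_pair[OF \<alpha>(1)] finite_pair[OF that]] card_pair \<alpha>(1) that by simp
  have prod3: "(\<Prod>i<3. f i) = f 0 * f 1 * f 2" and prod4: "(\<Prod>i<4. f i) = f 0 * f 1 * f 2 * f 3"
    for f :: "nat \<Rightarrow> nat" by (simp_all add: eval_nat_numeral)
  have w1: "w \<beta> \<le> N / (l - 5)" if \<beta>: "\<beta> \<in> A1" "\<beta> \<noteq> \<alpha>" for \<beta>
  proof -
    have \<beta>A: "\<beta> \<in> A" and ne: "\<alpha> \<inter> \<beta> \<noteq> {}" using \<beta> \<alpha>(2) by (auto simp: A1_def)
    have "\<not> \<alpha> \<subseteq> \<beta>"
      using card_subset_eq[OF finite_pair[OF \<beta>A], of \<alpha>] \<beta>(2) card_pair[OF \<alpha>(1)] card_pair[OF \<beta>A] by auto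
    then have "\<alpha> \<inter> \<beta> \<subset> \<alpha>" by blast
    from psubset_card_mono[OF finite_pair[OF \<alpha>(1)] this]
    have "card (\<alpha> \<inter> \<beta>) < 2" using card_pair[OF \<alpha>(1)] by simp
    moreover have "card (\<alpha> \<inter> \<beta>) > 0" using ne finite_pair[OF \<beta>A] by (simp add: card_gt_0_iff)
    ultimately have c3: "card (\<alpha> \<union> \<beta>) = 3" using card_un[OF \<beta>A] by linarith
    have "card (matchings_containing H (\<alpha> \<union> \<beta>)) * (\<Prod>i<3. card H - (2 * i + 1)) \<le> card (perfect_matchings H)"
      using card_matchings_containing_le[OF finite_H finite_UnI[OF finite_pair[OF \<alpha>(1)] finite_pair[OF \<beta>A]]]
      unfolding c3 .
    then have "real (card (matchings_containing H (\<alpha> \<union> \<beta>)) * ((card H - 1) * (card H - 3) * (card H - 5))) \<le> N"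
      unfolding N_def of_nat_le_iff prod3 by (simp add: mult.assoc)
    then have "w \<beta> * (l - 5) \<le> N" using large_H by (simp add: w_def l_def of_nat_diff mult_ac)
    then show ?thesis using l_ge by (simp add: field_simps)
  qed
  have w2: "w \<beta> \<le> N / ((l - 5) * (l - 7))" if \<beta>: "\<beta> \<in> A" "\<beta> \<notin> A1" for \<beta>
  proof -
    have "\<alpha> \<inter> \<beta> = {}" using \<beta> \<alpha>(2) by (auto simp: A1_def)
    then have c4: "card (\<alpha> \<union> \<beta>) = 4" using card_un[OF \<beta>(1)] by simp
    have "card (matchings_containing H (\<alpha> \<union> \<beta>)) * (\<Prod>i<4. card H - (2 * i + 1)) \<le> card (perfect_matchings H)"
      using card_matchings_containing_le[OF finite_H finite_UnI[OF finite_pair[OF \<alpha>(1)] finite_pair[OF \<beta>(1)]]]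
      unfolding c4 .
    then have "real (card (matchings_containing H (\<alpha> \<union> \<beta>)) * ((card H - 1) * (card H - 3) * (card H - 5) * (card H - 7))) \<le> N"
      unfolding N_def of_nat_le_iff prod4 by (simp add: mult.assoc)
    then have "w \<beta> * ((l - 5) * (l - 7)) \<le> N" using large_H by (simp add: w_def l_def of_nat_diff mult_ac)
    then show ?thesis using l_ge by (simp add: pos_le_divide_eq)
  qed
  have "(\<Sum>P\<in>perfect_matchings H. real (pair_count (resample a b c d P)))
      = (l - 1) * (l - 3) * (\<Sum>Q\<in>matchings_containing H \<alpha>. real (pair_count Q))"
    using sum_resample[OF \<alpha>(3,4), of "\<lambda>P. real (pair_count P)"] \<alpha>(2) large_H
    by (simp add: l_def of_nat_diff)
  also have "(\<Sum>Q\<in>matchings_containing H \<alpha>. real (pair_count Q))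
      = (\<Sum>\<beta>\<in>A. real (card (matchings_containing H (\<alpha> \<union> \<beta>))))"
    unfolding sum_pair_count[OF finite_matchings_containing[OF finite_H]]
    by (simp add: matchings_containing_def conj_assoc)
  also have "(l - 1) * (l - 3) * \<dots> = (\<Sum>\<beta>\<in>A. w \<beta>)" by (simp add: w_def sum_distrib_left)
  \<comment> \<open>\<open>\<alpha>\<close> also lies in \<open>A1\<close> and receives all three
    terms; the surplus is nonnegative and an upper bound is wanted.\<close>
  also have "\<dots> \<le> (\<Sum>\<beta>\<in>A. (if \<beta> = \<alpha> then N else 0) + (if \<beta> \<in> A1 then N / (l - 5) else 0) + N / ((l - 5) * (l - 7)))"
  proof (rule sum_mono)
    fix \<beta> assume "\<beta> \<in> A"
    moreover have "0 \<le> N / (l - 5)" "0 \<le> N / ((l - 5) * (l - 7))" using N_pos l_ge by simp_all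
    ultimately show "w \<beta> \<le> (if \<beta> = \<alpha> then N else 0) + (if \<beta> \<in> A1 then N / (l - 5) else 0) + N / ((l - 5) * (l - 7))"
      using w_self w1[of \<beta>] w2[of \<beta>] N_pos
      by (cases "\<beta> = \<alpha>"; cases "\<beta> \<in> A1") simp_all
  qed
  also have "\<dots> = N + real (card A1) * (N / (l - 5)) + real (card A) * (N / ((l - 5) * (l - 7)))"
  proof -
    have "A \<inter> A1 = A1" by (auto simp: A1_def)
    then show ?thesis using finite_A \<alpha>(1) by (simp add: sum.distrib sum.If_cases)
  qed
  also have "\<dots> \<le> N + 2 * B2 * (N / (l - 5)) + real (card A) * (N / ((l - 5) * (l - 7)))"
    using cA1 N_pos l_ge by (intro add_mono mult_right_mono) auto
  finally show ?thesis by (simp add: algebra_simps)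
qed

text \<open>Pairs of \<open>P\<close> away from the four points survive, and
  \<open>\<alpha>\<close>, which touches these points, comes on top of the survivors. So the loss is
  limited to pairs of \<open>P\<close> that touch them.\<close>

lemma pair_count_resample_ge:
  assumes \<alpha>: "\<alpha> \<in> A" "\<alpha> = {{a, b}, {c, d}}" "distinct [a, b, c, d]" "{a, b, c, d} \<subseteq> H"
    and P: "P \<in> perfect_matchings H"
  shows "pair_count P + 1
       \<le> pair_count (resample a b c d P) + card {\<beta> \<in> A. \<Union>\<beta> \<inter> {a, b, c, d} \<noteq> {} \<and> \<beta> \<subseteq> P}"
proof -
  let ?R = "resample a b c d P"
  have "{\<beta> \<in> A. \<beta> \<subseteq> P} \<subseteq> ({\<beta> \<in> A. \<beta> \<subseteq> ?R} - {\<alpha>}) \<union> {\<beta> \<in> A. \<Union>\<beta> \<inter> {a, b, c, d} \<noteq> {} \<and> \<beta> \<subseteq> P}"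
  proof (intro subsetI UnCI)
    fix \<beta> assume \<beta>: "\<beta> \<in> {\<beta> \<in> A. \<beta> \<subseteq> P}"
      and "\<beta> \<notin> {\<beta> \<in> A. \<Union>\<beta> \<inter> {a, b, c, d} \<noteq> {} \<and> \<beta> \<subseteq> P}"
    then have disj: "\<Union>\<beta> \<inter> {a, b, c, d} = {}" by blast
    then have "\<beta> \<noteq> \<alpha>" using \<alpha>(2) by auto
    moreover have "\<beta> \<subseteq> ?R"
      using resample_properties(3)[OF \<alpha>(3,4) P] \<beta> disj by blast
    ultimately show "\<beta> \<in> {\<beta> \<in> A. \<beta> \<subseteq> ?R} - {\<alpha>}" using \<beta> by blast
  qed
  then have "pair_count P \<le> card (({\<beta> \<in> A. \<beta> \<subseteq> ?R} - {\<alpha>}) \<union> {\<beta> \<in> A. \<Union>\<beta> \<inter> {a, b, c, d} \<noteq> {} \<and> \<beta> \<subseteq> P})"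
    unfolding pair_count_def using finite_A by (intro card_mono) auto
  also have "\<dots> \<le> card ({\<beta> \<in> A. \<beta> \<subseteq> ?R} - {\<alpha>}) + card {\<beta> \<in> A. \<Union>\<beta> \<inter> {a, b, c, d} \<noteq> {} \<and> \<beta> \<subseteq> P}"
    by (rule card_Un_le)
  finally have *: "pair_count P \<le> \<dots>" .
  have "\<alpha> \<in> {\<beta> \<in> A. \<beta> \<subseteq> ?R}" using resample_properties(2)[OF \<alpha>(3,4) P] \<alpha> by blast
  then have "Suc (card ({\<beta> \<in> A. \<beta> \<subseteq> ?R} - {\<alpha>})) = pair_count ?R"
    unfolding pair_count_def using finite_A by (intro card_Suc_Diff1) auto
  then show ?thesis using * by linarith
qed

lemma sum_resample_defect:
  assumes \<alpha>: "\<alpha> \<in> A" "\<alpha> = {{a, b}, {c, d}}" "distinct [a, b, c, d]" "{a, b, c, d} \<subseteq> H"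
  shows "(\<Sum>P\<in>perfect_matchings H. \<bar>real (pair_count (resample a b c d P)) - (real (pair_count P) + 1)\<bar>)
       \<le> N * defect"
proof -
  let ?PM = "perfect_matchings H" and ?R = "resample a b c d"
  define T where "T = {\<beta> \<in> A. \<Union>\<beta> \<inter> {a, b, c, d} \<noteq> {}}"
  define L where "L P = card {\<beta> \<in> T. \<beta> \<subseteq> P}" for P
  have finT: "finite T" using finite_A by (simp add: T_def)
  have cT: "real (card T) \<le> 4 * B1"
  proof -
    have "T = (\<Union>s\<in>{a, b, c, d}. {\<beta> \<in> A. s \<in> \<Union>\<beta>})" by (auto simp: T_def)
    moreover have "card (\<Union>s\<in>{a, b, c, d}. {\<beta> \<in> A. s \<in> \<Union>\<beta>}) \<le> (\<Sum>s\<in>{a, b, c, d}. card {\<beta> \<in> A. s \<in> \<Union>\<beta>})"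
      by (rule card_UN_le) simp
    ultimately have "card T \<le> (\<Sum>s\<in>{a, b, c, d}. card {\<beta> \<in> A. s \<in> \<Union>\<beta>})" by (simp only:)
    then have "real (card T) \<le> real (\<Sum>s\<in>{a, b, c, d}. card {\<beta> \<in> A. s \<in> \<Union>\<beta>})"
      unfolding of_nat_le_iff .
    also have "\<dots> = (\<Sum>s\<in>{a, b, c, d}. real (card {\<beta> \<in> A. s \<in> \<Union>\<beta>}))" by (rule of_nat_sum)
    also have "\<dots> \<le> (\<Sum>s\<in>{a, b, c, d}. B1)"
      by (intro sum_mono vertex_bound subsetD[OF \<alpha>(4)])
    also have "\<dots> = 4 * B1" using \<alpha>(3) by simp
    finally show ?thesis .
  qed
  have sL: "(\<Sum>P\<in>?PM. real (L P)) = real (card T) * N / ((l - 1) * (l - 3))"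
  proof -
    have "(\<Sum>P\<in>?PM. real (L P)) = (\<Sum>P\<in>?PM. \<Sum>\<beta>\<in>T. if \<beta> \<subseteq> P then 1 else 0)"
      using finT by (simp add: L_def sum.If_cases Int_def)
    also have "\<dots> = (\<Sum>\<beta>\<in>T. \<Sum>P\<in>?PM. if \<beta> \<subseteq> P then 1 else 0)" by (rule sum.swap)
    also have "\<dots> = (\<Sum>\<beta>\<in>T. real (card (matchings_containing H \<beta>)))"
      using finite_perfect_matchings[OF finite_H]
      by (simp add: sum.If_cases Int_def matchings_containing_def)
    also have "\<dots> = (\<Sum>\<beta>\<in>T. N / ((l - 1) * (l - 3)))"
      by (intro sum.cong refl card_matchings_containing_pair) (simp add: T_def)
    finally show ?thesis by simp
  qed
  \<comment> \<open>The map loses at most \<open>L P\<close> pairs, so the gain is controlled by its mean alone: \<open>\<bar>x\<bar> \<le> x + 2 L\<close> if \<open>x \<ge> - L\<close>.\<close>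
  have "(\<Sum>P\<in>?PM. \<bar>real (pair_count (?R P)) - (real (pair_count P) + 1)\<bar>)
      \<le> (\<Sum>P\<in>?PM. real (pair_count (?R P)) - real (pair_count P) - 1 + 2 * real (L P))"
  proof (rule sum_mono)
    fix P assume "P \<in> ?PM"
    then have "pair_count P + 1 \<le> pair_count (?R P) + L P"
      using pair_count_resample_ge[OF \<alpha>] by (simp add: L_def T_def conj_assoc)
    then show "\<bar>real (pair_count (?R P)) - (real (pair_count P) + 1)\<bar>
        \<le> real (pair_count (?R P)) - real (pair_count P) - 1 + 2 * real (L P)" by linarith
  qed
  also have "\<dots> = (\<Sum>P\<in>?PM. real (pair_count (?R P))) - real (card A) * N / ((l - 1) * (l - 3)) - N
      + 2 * (real (card T) * N / ((l - 1) * (l - 3)))"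
    unfolding sum.distrib sum_subtractf sum_distrib_left[symmetric] sum_pair_count_all sL
    by (simp add: N_def)
  \<comment> \<open>The contribution \<open>N\<close> of \<open>\<alpha>\<close> to the resampled
    counts cancels the \<open>- N\<close> that comes from the summand \<open>- 1\<close>; what is
    left is \<open>N * defect\<close>.\<close>
  also have "\<dots> \<le> N * (1 + 2 * B2 / (l - 5) + real (card A) / ((l - 5) * (l - 7)))
      - real (card A) * N / ((l - 1) * (l - 3)) - N + 2 * (4 * B1 * N / ((l - 1) * (l - 3)))"
    using sum_pair_count_resample_le[OF \<alpha>] cT N_pos l_ge
    by (intro add_mono diff_mono mult_left_mono divide_right_mono mult_right_mono) auto
  also have "\<dots> = N * defect" by (simp add: defect_def algebra_simps)
  finally show ?thesis .
qed

text \<open>\<open>N * defect\<close> dominates a sum of absolute values. The member of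
  \<open>A\<close> supplies the resampling behind that sum.\<close>

lemma defect_nonneg:
  assumes "\<alpha> \<in> A"
  shows "0 \<le> defect"
proof -
  obtain a b c d where \<alpha>: "\<alpha> = {{a, b}, {c, d}}" "distinct [a, b, c, d]" "{a, b, c, d} \<subseteq> H"
    using pairs[OF assms] by blast
  have "0 \<le> N * defect"
    by (rule order_trans[OF sum_nonneg sum_resample_defect[OF assms \<alpha>]]) simp
  then show ?thesis using N_pos by (simp add: zero_le_mult_iff)
qed

section \<open>Means over a uniform matching and approximate size bias\<close>

definition mean :: "('a set set \<Rightarrow> 'b :: real_vector) \<Rightarrow> 'b" where
  "mean g = (\<Sum>P\<in>perfect_matchings H. g P) /\<^sub>R N"

definition mean_count :: real where
  "mean_count = real (card A) / ((l - 1) * (l - 3))"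

lemma mean_pair_count: "mean (\<lambda>P. real (pair_count P)) = mean_count"
  using sum_pair_count_all N_pos by (simp add: mean_def mean_count_def)

text \<open>The exact identity \<open>E[M F(M)] = \<lambda> E[F(M + 1)]\<close> characterises the Poisson distribution.\<close>

lemma approximate_size_bias:
  fixes F :: "real \<Rightarrow> complex"
  assumes lip: "\<And>x y. norm (F x - F y) \<le> K * \<bar>x - y\<bar>"
  shows "norm (mean (\<lambda>P. pair_count P * F (pair_count P)) - mean_count * mean (\<lambda>P. F (real (pair_count P) + 1)))
       \<le> mean_count * K * defect"
proof -
  let ?PM = "perfect_matchings H"
  define c where "c = (l - 1) * (l - 3)"
  have c: "c > 0" using l_ge by (simp add: c_def)
  have K: "K \<ge> 0" using order_trans[OF norm_ge_zero lip[of 1 0]] by simp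
  define S where "S \<alpha> = (\<Sum>Q\<in>matchings_containing H \<alpha>. F (pair_count Q))" for \<alpha>
  define S1 where "S1 = (\<Sum>P\<in>?PM. F (real (pair_count P) + 1))"
  \<comment> \<open>By resampling, \<open>c * S \<alpha>\<close> is a sum over all matchings, which
    the Lipschitz bound compares with \<open>S1\<close> term by term.\<close>
  have one: "norm (c * S \<alpha> - S1) \<le> K * (N * defect)" if \<alpha>A: "\<alpha> \<in> A" for \<alpha>
  proof -
    obtain a b c' d where \<alpha>: "\<alpha> = {{a, b}, {c', d}}" "distinct [a, b, c', d]" "{a, b, c', d} \<subseteq> H"
      using pairs[OF \<alpha>A] by blast
    have "c * S \<alpha> = (\<Sum>P\<in>?PM. F (pair_count (resample a b c' d P)))"
      using sum_resample[OF \<alpha>(2,3), of "\<lambda>P. F (pair_count P)"] \<alpha>(1) large_H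
      by (simp add: c_def l_def of_nat_diff S_def)
    then have "norm (c * S \<alpha> - S1) = norm (\<Sum>P\<in>?PM. F (pair_count (resample a b c' d P)) - F (real (pair_count P) + 1))"
      by (simp add: S1_def sum_subtractf)
    also have "\<dots> \<le> (\<Sum>P\<in>?PM. K * \<bar>real (pair_count (resample a b c' d P)) - (real (pair_count P) + 1)\<bar>)"
      by (rule sum_norm_le) (rule lip)
    also have "\<dots> = K * (\<Sum>P\<in>?PM. \<bar>real (pair_count (resample a b c' d P)) - (real (pair_count P) + 1)\<bar>)"
      by (simp add: sum_distrib_left)
    also have "\<dots> \<le> K * (N * defect)"
      by (intro mult_left_mono sum_resample_defect[OF \<alpha>A \<alpha>] K)
    finally show ?thesis .
  qed
  \<comment> \<open>The factor \<open>pair_count P\<close> is a sum of indicators of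
    \<open>\<alpha> \<subseteq> P\<close>; exchange the two sums.\<close>
  have swap: "(\<Sum>P\<in>?PM. of_nat (pair_count P) * F (pair_count P)) = (\<Sum>\<alpha>\<in>A. S \<alpha>)"
  proof -
    have "(\<Sum>P\<in>?PM. of_nat (pair_count P) * F (pair_count P))
        = (\<Sum>P\<in>?PM. \<Sum>\<alpha>\<in>A. if \<alpha> \<subseteq> P then F (pair_count P) else 0)"
      using finite_A by (simp add: pair_count_def[of P for P] sum.If_cases Int_def)
    also have "\<dots> = (\<Sum>\<alpha>\<in>A. \<Sum>P\<in>?PM. if \<alpha> \<subseteq> P then F (pair_count P) else 0)" by (rule sum.swap)
    also have "\<dots> = (\<Sum>\<alpha>\<in>A. S \<alpha>)"
      using finite_perfect_matchings[OF finite_H]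
      by (simp add: sum.If_cases Int_def S_def matchings_containing_def)
    finally show ?thesis .
  qed
  have "norm (c * (\<Sum>\<alpha>\<in>A. S \<alpha>) - real (card A) * S1) = norm (\<Sum>\<alpha>\<in>A. c * S \<alpha> - S1)"
    by (simp add: sum_subtractf sum_distrib_left)
  also have "\<dots> \<le> (\<Sum>\<alpha>\<in>A. K * (N * defect))" by (rule sum_norm_le) (rule one)
  also have "\<dots> = real (card A) * (K * (N * defect))" by simp
  finally have *: "norm (c * (\<Sum>\<alpha>\<in>A. S \<alpha>) - real (card A) * S1) \<le> real (card A) * (K * (N * defect))" .
  have "mean (\<lambda>P. pair_count P * F (pair_count P)) - mean_count * mean (\<lambda>P. F (real (pair_count P) + 1))
      = (c * (\<Sum>\<alpha>\<in>A. S \<alpha>) - real (card A) * S1) / of_real (c * N)"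
    using c N_pos swap by (simp add: mean_def mean_count_def S1_def c_def[symmetric] scaleR_conv_of_real field_simps)
  then have "norm (mean (\<lambda>P. pair_count P * F (pair_count P)) - mean_count * mean (\<lambda>P. F (real (pair_count P) + 1)))
      = norm (c * (\<Sum>\<alpha>\<in>A. S \<alpha>) - real (card A) * S1) / (c * N)"
    using c N_pos by (simp add: norm_divide norm_mult)
  also have "\<dots> \<le> real (card A) * (K * (N * defect)) / (c * N)"
    using * c N_pos by (intro divide_right_mono) auto
  also have "\<dots> = mean_count * K * defect"
    using N_pos by (simp add: mean_count_def c_def)
  finally show ?thesis .
qed

end

section \<open>The characteristic function\<close>

lemma norm_iexp_diff_le: "norm (iexp a - iexp b) \<le> \<bar>a - b\<bar>"
proof -
  have "iexp a - iexp b = iexp b * (iexp (a - b) - 1)"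
    by (simp add: algebra_simps flip: exp_add)
  then have "norm (iexp a - iexp b) = norm (iexp (a - b) - 1)" by (simp add: norm_mult)
  also have "\<dots> \<le> \<bar>a - b\<bar>" using iexp_approx1[of "a - b" 0] by simp
  finally show ?thesis .
qed

context edge_pairs
begin

lemma mean_diff: "mean (\<lambda>P. f P - g P) = mean f - mean g"
  by (simp add: mean_def sum_subtractf scaleR_diff_right)

lemma mean_cmult: "mean (\<lambda>P. c * f P) = c * mean f" for c :: "'b :: real_algebra"
  by (simp add: mean_def flip: sum_distrib_left)

lemma norm_mean_le:
  fixes f :: "'a set set \<Rightarrow> 'b :: real_normed_vector"
  assumes "\<And>P. norm (f P) \<le> B"
  shows "norm (mean f) \<le> B"
proof -
  have "norm (\<Sum>P\<in>perfect_matchings H. f P) \<le> (\<Sum>P\<in>perfect_matchings H. B)"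
    using assms by (rule sum_norm_le)
  then have "norm (\<Sum>P\<in>perfect_matchings H. f P) \<le> N * B" by (simp add: N_def)
  then show ?thesis using N_pos by (simp add: mean_def field_simps)
qed

definition count_char :: "real \<Rightarrow> complex" where
  "count_char s = mean (\<lambda>P. iexp (s * ((pair_count P - mean_count) / sqrt mean_count)))"

definition count_char_deriv :: "real \<Rightarrow> complex" where
  "count_char_deriv s = mean (\<lambda>P. \<i> * ((pair_count P - mean_count) / sqrt mean_count)
     * iexp (s * ((pair_count P - mean_count) / sqrt mean_count)))"

lemma count_char_has_vector_derivative:
  "(count_char has_vector_derivative count_char_deriv s) (at s within T)"
proof -
  have "((\<lambda>s. iexp (s * y)) has_vector_derivative \<i> * y * iexp (s * y)) (at s within T)" for y :: real
    by (auto intro!: derivative_eq_intros simp: Re_exp Im_exp has_vector_derivative_complex_iff)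
  then show ?thesis
    unfolding count_char_def[abs_def] count_char_deriv_def mean_def
    by (intro bounded_linear.has_vector_derivative[OF bounded_linear_scaleR_right] has_vector_derivative_sum) 
qed

lemma norm_count_char_le: "norm (count_char s) \<le> 1"
  unfolding count_char_def by (rule norm_mean_le) simp

text \<open>Nearly the equation \<open>\<phi>' = - s \<phi>\<close> of \<open>exp (- s\<^sup>2 / 2)\<close>.\<close>

lemma count_char_deriv_bound:
  assumes pos: "mean_count > 0"
  shows "norm (count_char_deriv s + s * count_char s) \<le> s\<^sup>2 / (2 * sqrt mean_count) + \<bar>s\<bar> * defect"
proof -
  define \<sigma> where "\<sigma> = sqrt mean_count"
  have \<sigma>: "\<sigma> > 0" "mean_count = \<sigma> * \<sigma>" using pos by (simp_all add: \<sigma>_def)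
  define u where "u = s / \<sigma>"
  define F where "F x = iexp (s * ((x - mean_count) / \<sigma>))" for x :: real
  define r where "r = mean (\<lambda>P. pair_count P * F (pair_count P)) - mean_count * mean (\<lambda>P. F (real (pair_count P) + 1))"
  have "norm (F x - F y) \<le> \<bar>s\<bar> / \<sigma> * \<bar>x - y\<bar>" for x y
  proof -
    have "norm (F x - F y) \<le> \<bar>s * ((x - mean_count) / \<sigma>) - s * ((y - mean_count) / \<sigma>)\<bar>"
      unfolding F_def by (rule norm_iexp_diff_le)
    also have "s * ((x - mean_count) / \<sigma>) - s * ((y - mean_count) / \<sigma>) = s / \<sigma> * (x - y)"
      using \<sigma> by (simp add: field_simps)
    also have "\<bar>\<dots>\<bar> = \<bar>s\<bar> / \<sigma> * \<bar>x - y\<bar>" using \<sigma> by (simp add: abs_mult)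
    finally show ?thesis .
  qed
  then have r: "norm r \<le> mean_count * (\<bar>s\<bar> / \<sigma>) * defect"
    unfolding r_def by (rule approximate_size_bias)
  \<comment> \<open>For an exponential, adding one to the count is multiplication by a constant, so
    the mean of \<open>F (M + 1)\<close> is a multiple of \<open>count_char s\<close>.\<close>
  have shift: "F (x + 1) = iexp u * F x" for x
  proof -
    have "s * ((x + 1 - mean_count) / \<sigma>) = u + s * ((x - mean_count) / \<sigma>)"
      using \<sigma> by (simp add: u_def field_simps)
    then show ?thesis by (simp add: F_def exp_add distrib_left)
  qed
  have \<phi>: "count_char s = mean (\<lambda>P. F (pair_count P))" by (simp add: count_char_def F_def \<sigma>_def)
  have "count_char_deriv s = mean (\<lambda>P. (\<i> / \<sigma>) * (pair_count P * F (pair_count P) - mean_count * F (pair_count P)))"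
    unfolding count_char_deriv_def F_def \<sigma>_def[symmetric]
    by (rule arg_cong[where f = mean]) (auto simp: fun_eq_iff diff_divide_distrib algebra_simps)
  also have "\<dots> = (\<i> / \<sigma>) * (mean (\<lambda>P. pair_count P * F (pair_count P)) - mean_count * count_char s)"
    by (simp only: mean_cmult mean_diff \<phi>)
  also have "mean (\<lambda>P. pair_count P * F (pair_count P)) = r + mean_count * (iexp u * count_char s)"
    by (simp only: r_def shift mean_cmult \<phi>) simp
  also have "(\<i> / \<sigma>) * (r + mean_count * (iexp u * count_char s) - mean_count * count_char s)
      = (\<i> / \<sigma>) * r + (\<i> * \<sigma>) * (iexp u - 1) * count_char s"
    using \<sigma>(1) unfolding \<sigma>(2) by (simp add: field_simps)
  finally have "count_char_deriv s + s * count_char s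
      = (\<i> / \<sigma>) * r + ((\<i> * \<sigma>) * (iexp u - 1) + s) * count_char s" by (simp add: algebra_simps)
  \<comment> \<open>As \<open>(\<i> * \<sigma>) * (\<i> * u) = - s\<close>, the summand
    \<open>s\<close> removes the linear part of the exponential and leaves its quadratic Taylor
    remainder.\<close>
  also have "(\<i> * \<sigma>) * (iexp u - 1) + s = (\<i> * \<sigma>) * (iexp u - (1 + \<i> * u))"
    using \<sigma>(1) by (simp add: u_def algebra_simps)
  finally have "norm (count_char_deriv s + s * count_char s)
      \<le> norm ((\<i> / \<sigma>) * r) + norm ((\<i> * \<sigma>) * (iexp u - (1 + \<i> * u)) * count_char s)"
    by (metis norm_triangle_ineq)
  also have "norm ((\<i> / \<sigma>) * r) \<le> \<bar>s\<bar> * defect"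
  proof -
    have "norm ((\<i> / \<sigma>) * r) = norm r / \<sigma>" using \<sigma>(1) by (simp add: norm_mult norm_divide)
    also have "\<dots> \<le> mean_count * (\<bar>s\<bar> / \<sigma>) * defect / \<sigma>" using r \<sigma>(1) by (intro divide_right_mono) auto
    also have "\<dots> = \<bar>s\<bar> * defect" using \<sigma>(1) unfolding \<sigma>(2) by simp
    finally show ?thesis .
  qed
  also have "norm ((\<i> * \<sigma>) * (iexp u - (1 + \<i> * u)) * count_char s) \<le> s\<^sup>2 / (2 * \<sigma>)"
  proof -
    have "norm (iexp u - (1 + \<i> * u)) \<le> u\<^sup>2 / 2"
      using iexp_approx1[of u 1] by (simp add: eval_nat_numeral)
    then have "norm (iexp u - (1 + \<i> * u)) * norm (count_char s) \<le> u\<^sup>2 / 2 * 1"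
      using norm_count_char_le by (intro mult_mono) auto
    then have "\<sigma> * (norm (iexp u - (1 + \<i> * u)) * norm (count_char s)) \<le> \<sigma> * (u\<^sup>2 / 2 * 1)"
      using \<sigma>(1) by (intro mult_left_mono) auto
    also have "\<dots> = s\<^sup>2 / (2 * \<sigma>)" using \<sigma>(1) by (simp add: u_def power2_eq_square)
    finally show ?thesis using \<sigma>(1) by (simp add: norm_mult mult.assoc)
  qed
  finally show ?thesis by (simp add: \<sigma>_def)
qed

text \<open>The integrating factor \<open>exp (s\<^sup>2 / 2)\<close> turns the approximate
  differential equation into a bound on the derivative of \<open>g\<close>. The mean value
  inequality between 0 and \<open>t\<close> then compares \<open>g t\<close> with
  \<open>g 0 = 1\<close>.\<close>

lemma count_char_approx:
  assumes pos: "mean_count > 0" and defect: "0 \<le> defect"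
  shows "norm (count_char t - exp (- (t\<^sup>2) / 2)) \<le> \<bar>t\<bar> * (t\<^sup>2 / (2 * sqrt mean_count) + \<bar>t\<bar> * defect)"
proof -
  define E where "E s = complex_of_real (exp (s\<^sup>2 / 2))" for s :: real
  define g where "g s = count_char s * E s" for s
  \<comment> \<open>The bound on the derivative grows with \<open>\<bar>s\<bar>\<close>, so its
    value at \<open>t\<close> serves on the whole segment.\<close>
  define B where "B = exp (t\<^sup>2 / 2) * (t\<^sup>2 / (2 * sqrt mean_count) + \<bar>t\<bar> * defect)"
  have E: "(E has_vector_derivative of_real s * E s) (at s within S)" for s S
    unfolding E_def
    by (rule has_vector_derivative_eq_rhs[OF has_vector_derivative_of_real])
       (auto intro!: derivative_eq_intros simp flip: has_real_derivative_iff_has_vector_derivative)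
  have g: "(g has_vector_derivative (count_char_deriv s + s * count_char s) * E s) (at s within S)" for s S
    unfolding g_def
    by (rule has_vector_derivative_eq_rhs[OF has_vector_derivative_mult[OF count_char_has_vector_derivative E]])
       (simp add: algebra_simps)
  have "norm (g t - g 0) \<le> B * norm (t - 0)"
  proof (rule differentiable_bound[where S = "closed_segment 0 t"])
    fix s assume s: "s \<in> closed_segment 0 t"
    show "(g has_derivative (\<lambda>h. h *\<^sub>R ((count_char_deriv s + s * count_char s) * E s))) (at s within closed_segment 0 t)"
      using g by (simp add: has_vector_derivative_def)
    have abs: "\<bar>s\<bar> \<le> \<bar>t\<bar>" using s by (auto simp: closed_segment_eq_real_ivl split: if_splits)
    then have sq: "s\<^sup>2 \<le> t\<^sup>2" by (simp add: abs_le_square_iff)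
    have "onorm (\<lambda>h. h *\<^sub>R ((count_char_deriv s + s * count_char s) * E s)) \<le> norm ((count_char_deriv s + s * count_char s) * E s)"
      by (rule onorm_le) (simp add: mult.commute)
    also have "\<dots> = norm (count_char_deriv s + s * count_char s) * exp (s\<^sup>2 / 2)"
      by (simp add: norm_mult E_def)
    also have "\<dots> \<le> (s\<^sup>2 / (2 * sqrt mean_count) + \<bar>s\<bar> * defect) * exp (s\<^sup>2 / 2)"
      using count_char_deriv_bound[OF pos] by (intro mult_right_mono) auto
    also have "\<dots> \<le> (t\<^sup>2 / (2 * sqrt mean_count) + \<bar>t\<bar> * defect) * exp (t\<^sup>2 / 2)"
      using sq abs pos defect
      by (intro mult_mono add_mono divide_right_mono mult_right_mono) (auto intro!: add_nonneg_nonneg)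
    finally show "onorm (\<lambda>h. h *\<^sub>R ((count_char_deriv s + s * count_char s) * E s)) \<le> B"
      by (simp add: B_def mult.commute)
  qed auto
  moreover have "count_char 0 = 1" using N_pos by (simp add: count_char_def mean_def N_def scaleR_conv_of_real)
  ultimately have *: "norm (g t - 1) \<le> B * \<bar>t\<bar>" by (simp add: g_def E_def)
  have "count_char t - exp (- (t\<^sup>2) / 2) = exp (- (t\<^sup>2) / 2) * (g t - 1)"
    by (simp add: g_def E_def algebra_simps flip: of_real_mult exp_add)
  then have "norm (count_char t - exp (- (t\<^sup>2) / 2)) = exp (- (t\<^sup>2) / 2) * norm (g t - 1)"
    by (simp add: norm_mult)
  also have "\<dots> \<le> exp (- (t\<^sup>2) / 2) * (B * \<bar>t\<bar>)" using * by (intro mult_left_mono) auto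
  also have "\<dots> = \<bar>t\<bar> * (t\<^sup>2 / (2 * sqrt mean_count) + \<bar>t\<bar> * defect)"
    by (simp add: B_def mult_ac flip: exp_add)
  finally show ?thesis .
qed

end

section \<open>Pairs of parallel edges in the configuration model\<close>

lemma integral_pmf_of_set_sum:
  fixes f :: "'a \<Rightarrow> 'b :: {banach, second_countable_topology}"
  assumes "finite S" "S \<noteq> {}"
  shows "measure_pmf.expectation (pmf_of_set S) f = (\<Sum>x\<in>S. f x) /\<^sub>R real (card S)"
  using assms by (subst integral_measure_pmf[of S]) (auto simp: scaleR_sum_right divide_inverse)

text \<open>The pairs are ordered, so for a degree sequence their number is the numerator of
  \<open>nu\<close>.\<close>

definition siblings :: "(nat \<times> nat) set \<Rightarrow> ((nat \<times> nat) \<times> (nat \<times> nat)) set" where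
  "siblings H = {(a, b) \<in> H \<times> H. fst a = fst b \<and> a \<noteq> b}"

text \<open>Siblings \<open>a, a'\<close> at one vertex are joined to siblings \<open>b, b'\<close>
  at another. Each result arises from four choices, which the image identifies.\<close>

definition parallel_pairs :: "(nat \<times> nat) set \<Rightarrow> (nat \<times> nat) set set set" where
  "parallel_pairs H = (\<lambda>((a, a'), (b, b')). {{a, b}, {a', b'}})
     ` {(p, q) \<in> siblings H \<times> siblings H. fst (fst p) \<noteq> fst (fst q)}"

lemma parallel_pairsE:
  assumes "\<beta> \<in> parallel_pairs H"
  obtains a a' b b' where "\<beta> = {{a, b}, {a', b'}}" "a \<in> H" "a' \<in> H" "b \<in> H" "b' \<in> H"
    "fst a = fst a'" "fst b = fst b'" "a \<noteq> a'" "b \<noteq> b'" "fst a \<noteq> fst b"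
proof -
  from assms obtain a a' b b' where "\<beta> = {{a, b}, {a', b'}}"
    "(a, a') \<in> siblings H" "(b, b') \<in> siblings H" "fst a \<noteq> fst b"
    unfolding parallel_pairs_def by auto
  then show ?thesis by (intro that[of a b a' b']) (auto simp: siblings_def)
qed

lemma parallel_pairsI:
  assumes "a \<in> H" "a' \<in> H" "b \<in> H" "b' \<in> H" "fst a = fst a'" "fst b = fst b'" "a \<noteq> a'" "b \<noteq> b'" "fst a \<noteq> fst b"
  shows "{{a, b}, {a', b'}} \<in> parallel_pairs H"
  unfolding parallel_pairs_def siblings_def
  by (rule image_eqI[where x = "((a, a'), (b, b'))"]) (use assms in auto)

lemma finite_siblings: "finite H \<Longrightarrow> finite (siblings H)"
  unfolding siblings_def by (rule finite_subset[of _ "H \<times> H"]) auto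

lemma finite_parallel_pairs: "finite H \<Longrightarrow> finite (parallel_pairs H)"
  unfolding parallel_pairs_def
  by (intro finite_imageI, rule finite_subset[of _ "siblings H \<times> siblings H"]) (auto simp: finite_siblings)

lemma card_parallel_pairs_le:
  assumes "finite H"
  shows "card (parallel_pairs H) \<le> card (siblings H) ^ 2"
proof -
  have "card (parallel_pairs H) \<le> card {(p, q) \<in> siblings H \<times> siblings H. fst (fst p) \<noteq> fst (fst q)}"
    unfolding parallel_pairs_def using assms
    by (intro card_image_le, rule_tac finite_subset[of _ "siblings H \<times> siblings H"]) (auto simp: finite_siblings)
  also have "\<dots> \<le> card (siblings H \<times> siblings H)"
    using assms by (intro card_mono) (auto simp: finite_siblings)
  finally show ?thesis by (simp add: card_cartesian_product power2_eq_square)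
qed

lemma parallel_pairs_form:
  assumes "\<alpha> \<in> parallel_pairs H"
  shows "\<exists>a b c d. \<alpha> = {{a, b}, {c, d}} \<and> distinct [a, b, c, d] \<and> {a, b, c, d} \<subseteq> H"
  using assms
proof (cases rule: parallel_pairsE)
  case (1 a a' b b')
  then show ?thesis by (intro exI[of _ a] exI[of _ b] exI[of _ a'] exI[of _ b']) auto
qed

text \<open>Such a pair is determined by the other half-edge it uses at the vertex of
  \<open>s\<close> and by the ordered siblings at the far ends. The four cases are the positions
  \<open>s\<close> can have.\<close>

lemma card_parallel_pairs_at_le:
  assumes H: "finite H" and D: "\<And>i. card {x \<in> H. fst x = i} \<le> D"
  shows "card {\<beta> \<in> parallel_pairs H. s \<in> \<Union>\<beta>} \<le> D * card (siblings H)"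
proof -
  let ?X = "{x \<in> H. fst x = fst s} \<times> siblings H"
  let ?f = "\<lambda>(s', (b, b')). {{s, b}, {s', b'}}"
  have "{\<beta> \<in> parallel_pairs H. s \<in> \<Union>\<beta>} \<subseteq> ?f ` ?X"
  proof
    fix \<beta> assume \<beta>: "\<beta> \<in> {\<beta> \<in> parallel_pairs H. s \<in> \<Union>\<beta>}"
    then have "\<beta> \<in> parallel_pairs H" by blast
    then show "\<beta> \<in> ?f ` ?X"
    proof (cases rule: parallel_pairsE)
      case (1 a a' b b')
      then consider "s = a" | "s = a'" | "s = b" | "s = b'" using \<beta> by auto
      then show ?thesis
      proof cases
        assume "s = a"
        then show ?thesis using 1 by (intro image_eqI[of _ _ "(a', (b, b'))"]) (auto simp: siblings_def)
      next
        assume "s = a'"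
        then show ?thesis using 1 by (intro image_eqI[of _ _ "(a, (b', b))"]) (auto simp: siblings_def)
      next
        assume "s = b"
        then show ?thesis using 1 by (intro image_eqI[of _ _ "(b', (a, a'))"]) (auto simp: siblings_def insert_commute)
      next
        assume "s = b'"
        then show ?thesis using 1 by (intro image_eqI[of _ _ "(b, (a', a))"]) (auto simp: siblings_def insert_commute)
      qed
    qed
  qed
  moreover have fin: "finite ?X" using H by (simp add: finite_siblings)
  ultimately have "card {\<beta> \<in> parallel_pairs H. s \<in> \<Union>\<beta>} \<le> card ?X" by (meson surj_card_le)
  also have "\<dots> \<le> D * card (siblings H)" using D by (simp add: card_cartesian_product)
  finally show ?thesis .
qed

text \<open>If \<open>e = {x, y}\<close>, the second edge joins a half-edge at the vertex of
  \<open>x\<close> to one at the vertex of \<open>y\<close>, with at most \<open>D\<close> choices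
  each.\<close>

lemma card_parallel_pairs_edge_le:
  assumes H: "finite H" and D: "\<And>i. card {x \<in> H. fst x = i} \<le> D"
  shows "card {\<beta> \<in> parallel_pairs H. e \<in> \<beta>} \<le> D ^ 2"
proof (cases "\<exists>x y. e = {x, y}")
  case False
  then have "{\<beta> \<in> parallel_pairs H. e \<in> \<beta>} = {}" by (auto elim!: parallel_pairsE)
  then show ?thesis by (simp only: card.empty)
next
  case True
  then obtain x y where e: "e = {x, y}" by blast
  let ?X = "{u \<in> H. fst u = fst x} \<times> {v \<in> H. fst v = fst y}"
  let ?f = "\<lambda>(u, v). {{x, y}, {u, v}}"
  have "{\<beta> \<in> parallel_pairs H. e \<in> \<beta>} \<subseteq> ?f ` ?X"
  proof
    fix \<beta> assume \<beta>: "\<beta> \<in> {\<beta> \<in> parallel_pairs H. e \<in> \<beta>}"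
    then have "\<beta> \<in> parallel_pairs H" by blast
    then show "\<beta> \<in> ?f ` ?X"
    proof (cases rule: parallel_pairsE)
      case (1 a a' b b')
      then consider "x = a" "y = b" | "x = b" "y = a" | "x = a'" "y = b'" | "x = b'" "y = a'"
        using \<beta> e by (auto simp: doubleton_eq_iff)
      then show ?thesis
      proof cases
        case a: 1
        then show ?thesis using 1 by (intro image_eqI[of _ _ "(a', b')"]) auto
      next
        case a: 2
        then show ?thesis using 1 by (intro image_eqI[of _ _ "(b', a')"]) (auto simp: insert_commute)
      next
        case a: 3
        then show ?thesis using 1 by (intro image_eqI[of _ _ "(a, b)"]) auto
      next
        case a: 4
        then show ?thesis using 1 by (intro image_eqI[of _ _ "(b, a)"]) (auto simp: insert_commute)
      qed
    qed
  qed
  moreover have fin: "finite ?X" using H by simp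
  ultimately have "card {\<beta> \<in> parallel_pairs H. e \<in> \<beta>} \<le> card ?X" by (meson surj_card_le)
  also have "\<dots> \<le> D ^ 2"
    using D by (simp add: card_cartesian_product power2_eq_square mult_le_mono)
  finally show ?thesis .
qed

text \<open>A pair of parallel edges comes from few quadruples of half-edges, since it determines their set.\<close>

lemma card_siblings_square_le:
  assumes H: "finite H" and D: "\<And>i. card {x \<in> H. fst x = i} \<le> D"
  shows "card (siblings H) ^ 2 \<le> 256 * card (parallel_pairs H) + D ^ 2 * card (siblings H)"
proof -
  let ?S = "siblings H"
  \<comment> \<open>\<open>U \<alpha>\<close> holds all quadruples of half-edges of
    \<open>\<alpha>\<close>, at most \<open>4 ^ 4 = 256\<close> of them.\<close>
  define U where "U \<alpha> = (\<Union>\<alpha> \<times> \<Union>\<alpha>) \<times> (\<Union>\<alpha> \<times> \<Union>\<alpha>)" for \<alpha> :: "(nat \<times> nat) set set"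
  \<comment> \<open>\<open>Q p\<close> contains the siblings at the same vertex as \<open>p\<close>;
    joining these to \<open>p\<close> gives loops instead of parallel edges.\<close>
  define Q where "Q p = {x \<in> H. fst x = fst (fst p)} \<times> {x \<in> H. fst x = fst (fst p)}" for p :: "(nat \<times> nat) \<times> (nat \<times> nat)"
  have sub: "?S \<times> ?S \<subseteq> (\<Union>\<alpha>\<in>parallel_pairs H. U \<alpha>) \<union> (SIGMA p:?S. Q p)"
  proof
    fix pq assume "pq \<in> ?S \<times> ?S"
    then obtain a a' b b' where pq: "pq = ((a, a'), (b, b'))" and S: "(a, a') \<in> ?S" "(b, b') \<in> ?S"
      by (cases pq, cases "fst pq", cases "snd pq") auto
    show "pq \<in> (\<Union>\<alpha>\<in>parallel_pairs H. U \<alpha>) \<union> (SIGMA p:?S. Q p)"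
    proof (cases "fst a = fst b")
      case True
      then have "pq \<in> (SIGMA p:?S. Q p)" using S by (auto simp: pq Q_def siblings_def)
      then show ?thesis by blast
    next
      case False
      then have "{{a, b}, {a', b'}} \<in> parallel_pairs H"
        using S by (intro parallel_pairsI) (auto simp: siblings_def)
      moreover have "pq \<in> U {{a, b}, {a', b'}}" by (simp add: pq U_def)
      ultimately show ?thesis by blast
    qed
  qed
  have finQ: "finite (SIGMA p:?S. Q p)"
    using H finite_siblings[OF H] by (intro finite_SigmaI) (simp_all add: Q_def)
  have U: "finite (U \<alpha>)" "card (U \<alpha>) \<le> 256" if \<alpha>: "\<alpha> \<in> parallel_pairs H" for \<alpha>
  proof -
    obtain a b c d where "\<alpha> = {{a, b}, {c, d}}" using parallel_pairs_form[OF \<alpha>] by blast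
    then have eq: "\<Union>\<alpha> = set [a, b, c, d]" by auto
    then show "finite (U \<alpha>)" unfolding U_def by (intro finite_cartesian_product) simp_all
    have "card (\<Union>\<alpha>) \<le> 4" unfolding eq by (rule order_trans[OF card_length]) simp
    then have "card (U \<alpha>) \<le> (4 * 4) * (4 * 4)"
      unfolding U_def card_cartesian_product by (intro mult_le_mono)
    then show "card (U \<alpha>) \<le> 256" by simp
  qed
  have "card (?S \<times> ?S) \<le> card ((\<Union>\<alpha>\<in>parallel_pairs H. U \<alpha>) \<union> (SIGMA p:?S. Q p))"
    by (rule card_mono[OF _ sub]) (intro finite_UnI finite_UN_I finite_parallel_pairs[OF H] U(1) finQ)
  also have "\<dots> \<le> card (\<Union>\<alpha>\<in>parallel_pairs H. U \<alpha>) + card (SIGMA p:?S. Q p)" by (rule card_Un_le)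
  also have "card (\<Union>\<alpha>\<in>parallel_pairs H. U \<alpha>) \<le> (\<Sum>\<alpha>\<in>parallel_pairs H. 256)"
    by (rule order_trans[OF card_UN_le[OF finite_parallel_pairs[OF H]]]) (intro sum_mono U(2))
  also have "card (SIGMA p:?S. Q p) = (\<Sum>p\<in>?S. card (Q p))"
    by (rule card_SigmaI[OF finite_siblings[OF H]]) (simp add: Q_def H)
  also have "\<dots> \<le> (\<Sum>p\<in>?S. D ^ 2)"
    unfolding Q_def card_cartesian_product power2_eq_square by (intro sum_mono mult_le_mono D)
  finally show ?thesis by (simp add: card_cartesian_product power2_eq_square mult_ac)
qed

section \<open>Half-edges of a degree sequence and the resulting multigraph\<close>

lemma finite_half_edges: "finite (half_edges n d)"
  by (simp add: half_edges_def)

lemma card_half_edges: "card (half_edges n d) = (\<Sum>i\<in>{1..n}. d i)"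
  by (simp add: half_edges_def)

lemma half_edges_at: "{x \<in> half_edges n d. fst x = i} = (if i \<in> {1..n} then {i} \<times> {..<d i} else {})"
  by (auto simp: half_edges_def)

text \<open>Each half-edge at \<open>i\<close> has \<open>d i - 1\<close> siblings.\<close>

lemma card_siblings_half_edges:
  "real (card (siblings (half_edges n d))) = (\<Sum>i\<in>{1..n}. real (d i) * (real (d i) - 1))"
proof -
  let ?H = "half_edges n d"
  let ?B = "\<lambda>a. {x \<in> ?H. fst x = fst a} - {a}"
  have "siblings ?H = (SIGMA a:?H. ?B a)" by (auto simp: siblings_def)
  then have "card (siblings ?H) = (\<Sum>a\<in>?H. card (?B a))"
    using finite_half_edges by (simp add: card_SigmaI)
  also have "\<dots> = (\<Sum>a\<in>?H. d (fst a) - 1)"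
  proof (rule sum.cong[OF refl])
    fix a assume "a \<in> ?H"
    then show "card (?B a) = d (fst a) - 1"
      using finite_half_edges[of n d]
      by (subst card_Diff_singleton) (auto simp: half_edges_at card_cartesian_product, auto simp: half_edges_def)
  qed
  also have "\<dots> = (\<Sum>i\<in>{1..n}. \<Sum>k\<in>{..<d i}. d i - 1)"
    unfolding half_edges_def by (subst sum.Sigma) (auto simp: case_prod_beta)
  finally have "card (siblings ?H) = (\<Sum>i\<in>{1..n}. d i * (d i - 1))" by simp
  then have "real (card (siblings ?H)) = (\<Sum>i\<in>{1..n}. real (d i * (d i - 1)))" by simp
  also have "\<dots> = (\<Sum>i\<in>{1..n}. real (d i) * (real (d i) - 1))"
  \<comment> \<open>After multiplication by \<open>d i\<close>, truncated and real subtraction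
    agree, also for \<open>d i = 0\<close>.\<close>
  proof (rule sum.cong[OF refl])
    show "real (d i * (d i - 1)) = real (d i) * (real (d i) - 1)" for i by (cases "d i") (simp_all add: algebra_simps)
  qed
  finally show ?thesis .
qed

lemma edge_count_matching:
  assumes "finite P"
  shows "edge_count (matching_multigraph P) i j = card {e \<in> P. fst ` e = {i, j}}"
  using assms by (simp add: edge_count_def matching_multigraph_def count_image_mset Int_def vimage_def conj_commute)

lemma edge_endpoints:
  assumes "card e = 2" "fst ` e = {i, j}" "i \<noteq> j"
  obtains a b where "e = {a, b}" "fst a = i" "fst b = j"
proof -
  obtain a b where "e = {a, b}" using assms(1) by (auto simp: card_2_iff)
  then have "e = {a, b} \<and> fst a = i \<and> fst b = j \<or> e = {b, a} \<and> fst b = i \<and> fst a = j"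
    using assms(2,3) by (auto simp: doubleton_eq_iff)
  then show ?thesis using that by blast
qed

text \<open>A binomial coefficient \<open>edge_count choose 2\<close> counts the two-element sets of
  edges between \<open>i\<close> and \<open>j\<close>. For different \<open>i < j\<close> these sets
  are different, and together they are the parallel pairs inside \<open>P\<close>.\<close>

lemma multi_edge_count_eq:
  assumes P: "P \<in> perfect_matchings (half_edges n d)"
  shows "multi_edge_count n (matching_multigraph P) = card {\<beta> \<in> parallel_pairs (half_edges n d). \<beta> \<subseteq> P}"
proof -
  let ?H = "half_edges n d"
  define E where "E x = {e \<in> P. fst ` e = {snd x, fst x}}" for x :: "nat \<times> nat"
  define C where "C x = {\<beta>. \<beta> \<subseteq> E x \<and> card \<beta> = 2}" for x
  define I where "I = (SIGMA j:{1..n}. {1..<j})"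
  have finP: "finite P" using P finite_half_edges by (rule perfect_matchings_finite_edges[rotated])
  then have finE: "finite (E x)" for x by (simp add: E_def)
  have "multi_edge_count n (matching_multigraph P) = (\<Sum>j\<in>{1..n}. \<Sum>i\<in>{1..<j}. card (E (j, i)) choose 2)"
    using finP by (simp add: multi_edge_count_def edge_count_matching E_def)
  also have "\<dots> = (\<Sum>x\<in>I. card (C x))"
    using finE by (simp add: I_def C_def n_subsets sum.Sigma case_prod_beta)
  also have "\<dots> = card (\<Union>x\<in>I. C x)"
  proof (rule card_UN_disjoint[symmetric])
    show "finite I" by (simp add: I_def)
    show "\<forall>x\<in>I. finite (C x)"
      using finE by (auto simp: C_def intro: finite_subset[of _ "Pow (E x)" for x])
    show "\<forall>x\<in>I. \<forall>y\<in>I. x \<noteq> y \<longrightarrow> C x \<inter> C y = {}"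
    proof (intro ballI impI)
      fix x y assume xy: "x \<in> I" "y \<in> I" "x \<noteq> y"
      show "C x \<inter> C y = {}"
      proof (rule ccontr)
        assume "C x \<inter> C y \<noteq> {}"
        then obtain \<beta> where \<beta>: "\<beta> \<subseteq> E x" "\<beta> \<subseteq> E y" "card \<beta> = 2" by (auto simp: C_def)
        then obtain e where "e \<in> \<beta>" by fastforce
        then have "e \<in> E x" "e \<in> E y" using \<beta> by blast+
        then have "fst ` e = {snd x, fst x}" "fst ` e = {snd y, fst y}" by (simp_all add: E_def)
        then have "{snd x, fst x} = {snd y, fst y}" by (simp only:)
        then show False using xy by (auto simp: I_def doubleton_eq_iff prod_eq_iff)
      qed
    qed
  qed
  also have "(\<Union>x\<in>I. C x) = {\<beta> \<in> parallel_pairs ?H. \<beta> \<subseteq> P}"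
  proof (intro set_eqI iffI)
    fix \<beta> assume "\<beta> \<in> (\<Union>x\<in>I. C x)"
    then obtain i j where ij: "i < j" and \<beta>: "\<beta> \<subseteq> E (j, i)" "card \<beta> = 2" by (auto simp: I_def C_def)
    from \<beta>(2) obtain e f where ef: "\<beta> = {e, f}" "e \<noteq> f" by (auto simp: card_2_iff)
    have e: "e \<in> P" "fst ` e = {i, j}" and f: "f \<in> P" "fst ` f = {i, j}" using \<beta> ef by (auto simp: E_def)
    obtain a b where ab: "e = {a, b}" "fst a = i" "fst b = j"
      using edge_endpoints[OF perfect_matchings_card_edge[OF P e(1)] e(2) less_imp_neq[OF ij]] by blast
    obtain a' b' where ab': "f = {a', b'}" "fst a' = i" "fst b' = j"
      using edge_endpoints[OF perfect_matchings_card_edge[OF P f(1)] f(2) less_imp_neq[OF ij]] by blast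
    \<comment> \<open>Distinct edges of a matching share no half-edge.\<close>
    have "a \<noteq> a'" "b \<noteq> b'"
      using perfect_matchings_unique_edge[OF P e(1) f(1), of a]
        perfect_matchings_unique_edge[OF P e(1) f(1), of b] ab(1) ab'(1) ef(2) by auto
    then have "{{a, b}, {a', b'}} \<in> parallel_pairs ?H"
      using perfect_matchings_edge[OF P] e f ab ab' ij by (intro parallel_pairsI) auto
    then show "\<beta> \<in> {\<beta> \<in> parallel_pairs ?H. \<beta> \<subseteq> P}" using ef ab ab' e f by auto
  next
    fix \<beta> assume "\<beta> \<in> {\<beta> \<in> parallel_pairs ?H. \<beta> \<subseteq> P}"
    then have "\<beta> \<in> parallel_pairs ?H" and sub: "\<beta> \<subseteq> P" by blast+
    then show "\<beta> \<in> (\<Union>x\<in>I. C x)"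
    proof (cases rule: parallel_pairsE)
      case (1 a a' b b')
      \<comment> \<open>The two vertices of a pair come in no order, whereas indices in
        \<open>I\<close> have the larger vertex first.\<close>
      let ?x = "(max (fst a) (fst b), min (fst a) (fst b))"
      have "{a, b} \<noteq> {a', b'}" using 1 by (auto simp: doubleton_eq_iff)
      then have "card \<beta> = 2" using 1 by simp
      moreover have "\<beta> \<subseteq> E ?x" using 1 sub by (auto simp: E_def max_def min_def)
      moreover have "?x \<in> I" using 1 by (auto simp: I_def half_edges_def max_def min_def)
      ultimately show ?thesis unfolding C_def by blast
    qed
  qed
  finally show ?thesis .
qed

lemma edge_pairs_half_edges:
  assumes "even (\<Sum>i\<in>{1..n}. d i)" "(\<Sum>i\<in>{1..n}. d i) \<ge> 16" "\<And>i. i \<in> {1..n} \<Longrightarrow> d i \<le> D"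
  shows "edge_pairs (half_edges n d) (parallel_pairs (half_edges n d))
    (real D * real (card (siblings (half_edges n d)))) (real D ^ 2)"
proof
  let ?H = "half_edges n d"
  have D: "card {x \<in> ?H. fst x = i} \<le> D" for i
    using assms(3) by (simp add: half_edges_at card_cartesian_product)
  show "finite ?H" by (rule finite_half_edges)
  show "even (card ?H)" "16 \<le> card ?H" using assms by (simp_all add: card_half_edges)
  show "finite (parallel_pairs ?H)" by (simp add: finite_parallel_pairs finite_half_edges)
  show "\<And>\<alpha>. \<alpha> \<in> parallel_pairs ?H \<Longrightarrow> \<exists>a b c d. \<alpha> = {{a, b}, {c, d}} \<and> distinct [a, b, c, d] \<and> {a, b, c, d} \<subseteq> ?H"
    by (rule parallel_pairs_form)
  show "real (card {\<beta> \<in> parallel_pairs ?H. s \<in> \<Union>\<beta>}) \<le> real D * real (card (siblings ?H))" for s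
    using card_parallel_pairs_at_le[OF finite_half_edges D] by (metis of_nat_le_iff of_nat_mult)
  show "real (card {\<beta> \<in> parallel_pairs ?H. e \<in> \<beta>}) \<le> real D ^ 2" for e
    using card_parallel_pairs_edge_le[OF finite_half_edges D] by (metis of_nat_le_iff of_nat_power)
qed

section \<open>The central limit theorem\<close>

text \<open>The left side is \<open>defect\<close> for \<open>B1 = D * S\<close>,
  \<open>B2 = D\<^sup>2\<close> and \<open>c\<close> pairs. Its three terms contribute
  \<open>84 = 16 + 4 + 64\<close>; \<open>L \<ge> 16\<close> allows the shifted products to be
  replaced by \<open>L\<^sup>2 / 2\<close> and \<open>L\<^sup>2 / 4\<close>.\<close>

lemma defect_estimate:
  fixes L D S c :: real
  assumes L: "L \<ge> 16" and D: "0 \<le> D" and S: "0 \<le> S" "S \<le> D * L" and c: "c \<le> S\<^sup>2"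
  shows "8 * (D * S) / ((L - 1) * (L - 3)) + 2 * D\<^sup>2 / (L - 5)
      + c * (1 / ((L - 5) * (L - 7)) - 1 / ((L - 1) * (L - 3))) \<le> 84 * D\<^sup>2 / L"
proof -
  have m1: "(L - 1) * (L - 3) \<ge> L\<^sup>2 / 2" and m2: "(L - 5) * (L - 7) \<ge> L\<^sup>2 / 4"
  proof -
    have "0 \<le> (L - 16) * (L - 16)" "0 \<le> (L - 16) * L" using L by simp_all
    then show "(L - 1) * (L - 3) \<ge> L\<^sup>2 / 2" "(L - 5) * (L - 7) \<ge> L\<^sup>2 / 4"
      using L by (simp_all add: algebra_simps power2_eq_square)
  qed
  have L2: "L\<^sup>2 > 0" using L by simp
  have "8 * (D * S) / ((L - 1) * (L - 3)) \<le> 8 * (D * (D * L)) / (L\<^sup>2 / 2)"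
    using m1 D S L L2 by (intro frac_le mult_left_mono mult_nonneg_nonneg) auto
  also have "\<dots> = 16 * D\<^sup>2 / L" using L by (simp add: field_simps power2_eq_square)
  finally have t1: "8 * (D * S) / ((L - 1) * (L - 3)) \<le> 16 * D\<^sup>2 / L" .
  have "2 * D\<^sup>2 / (L - 5) \<le> 2 * D\<^sup>2 / (L / 2)" using L by (intro divide_left_mono) auto
  also have "\<dots> = 4 * D\<^sup>2 / L" by simp
  finally have t2: "2 * D\<^sup>2 / (L - 5) \<le> 4 * D\<^sup>2 / L" .
  \<comment> \<open>The leading terms cancel, so the difference has order \<open>1 / L ^ 3\<close>.
    Against \<open>c \<le> (D * L)\<^sup>2\<close> a single reciprocal would only give order
    \<open>D\<^sup>2\<close>.\<close>
  have "1 / ((L - 5) * (L - 7)) - 1 / ((L - 1) * (L - 3)) = (8 * L - 32) / (((L - 5) * (L - 7)) * ((L - 1) * (L - 3)))"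
    using L by (simp add: divide_simps) (simp add: algebra_simps)
  also have "\<dots> \<le> 8 * L / ((L\<^sup>2 / 4) * (L\<^sup>2 / 2))"
    using m1 m2 L L2 by (intro frac_le mult_mono) auto
  also have "\<dots> = 64 / L ^ 3" using L by (simp add: field_simps eval_nat_numeral)
  finally have "1 / ((L - 5) * (L - 7)) - 1 / ((L - 1) * (L - 3)) \<le> 64 / L ^ 3" .
  moreover have "0 \<le> 1 / ((L - 5) * (L - 7)) - 1 / ((L - 1) * (L - 3))"
  proof -
    have "(L - 5) * (L - 7) \<le> (L - 1) * (L - 3)" using L by (intro mult_mono) auto
    then show ?thesis using L by (simp add: frac_le)
  qed
  moreover have "S\<^sup>2 \<le> (D * L)\<^sup>2" using S by (intro power_mono)
  ultimately have "c * (1 / ((L - 5) * (L - 7)) - 1 / ((L - 1) * (L - 3))) \<le> (D * L)\<^sup>2 * (64 / L ^ 3)"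
    using c by (intro mult_mono) auto
  also have "\<dots> = 64 * D\<^sup>2 / L" using L by (simp add: field_simps eval_nat_numeral)
  finally show ?thesis using t1 t2 by (simp add: add_divide_distrib[symmetric])
qed

section \<open>The configuration model as a uniform perfect matching\<close>

lemma expectation_config_model:
  fixes g :: "nat set multiset \<Rightarrow> 'b :: {banach, second_countable_topology}"
  assumes "even (\<Sum>i\<in>{1..n}. d i)"
  shows "measure_pmf.expectation (config_model n d) g
    = (\<Sum>P\<in>perfect_matchings (half_edges n d). g (matching_multigraph P))
        /\<^sub>R real (card (perfect_matchings (half_edges n d)))"
  \<comment> \<open>An even degree sum makes the set of matchings nonempty, so
    \<open>pmf_of_set\<close> is the uniform distribution on it.\<close>
  unfolding config_model_def integral_map_pmf
  using assms by (intro integral_pmf_of_set_sum finite_perfect_matchings perfect_matchings_nonempty finite_half_edges)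
    (simp add: card_half_edges)

locale config =
  fixes n :: nat and d :: "nat \<Rightarrow> nat" and D :: nat
  assumes even: "even (\<Sum>i\<in>{1..n}. d i)" and large: "(\<Sum>i\<in>{1..n}. d i) \<ge> 16"
    and degree_le: "\<And>i. i \<in> {1..n} \<Longrightarrow> d i \<le> D"
begin

abbreviation "H \<equiv> half_edges n d"

sublocale edge_pairs H "parallel_pairs H" "real D * real (card (siblings H))" "real D ^ 2"
  by (rule edge_pairs_half_edges) (rule even, rule large, rule degree_le)

lemma multi_edge_count_pair_count:
  "P \<in> perfect_matchings H \<Longrightarrow> multi_edge_count n (matching_multigraph P) = pair_count P"
  by (simp add: multi_edge_count_eq pair_count_def)

lemma mean_multi_edge_count_eq: "mean_multi_edge_count n d = mean_count"
  unfolding mean_multi_edge_count_def expectation_config_model[OF even] mean_pair_count[symmetric] mean_def N_def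
  by (simp add: multi_edge_count_pair_count cong: sum.cong)

lemma l_eq: "l = (\<Sum>i\<in>{1..n}. real (d i))"
  by (simp add: l_def card_half_edges)

lemma char_multi_edge_count:
  "char (distr (measure_pmf (config_model n d)) borel
       (\<lambda>G. (real (multi_edge_count n G) - mean_multi_edge_count n d) / sqrt (mean_multi_edge_count n d))) t
   = count_char t"
  unfolding char_def
  by (subst integral_distr)
     (simp_all add: expectation_config_model[OF even] count_char_def mean_def N_def
        multi_edge_count_pair_count mean_multi_edge_count_eq cong: sum.cong)

lemma siblings_le: "real (card (siblings H)) \<le> real D * l"
proof -
  have "real (d i) * (real (d i) - 1) \<le> real D * real (d i)" if "i \<in> {1..n}" for i
  proof -
    have "real (d i) * (real (d i) - 1) \<le> real (d i) * real D"
      using degree_le[OF that] by (intro mult_left_mono) auto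
    then show ?thesis by (simp add: mult.commute)
  qed
  then show ?thesis
    unfolding card_siblings_half_edges l_eq sum_distrib_left by (intro sum_mono)
qed

lemma nu_eq: "nu n d = real (card (siblings H)) / l"
  by (simp add: nu_def card_siblings_half_edges l_eq)

lemma defect_le: "defect \<le> 84 * (real D)\<^sup>2 / l"
  unfolding defect_def
  using defect_estimate[OF l_ge, of D "card (siblings H)" "card (parallel_pairs H)"] siblings_le
    card_parallel_pairs_le[OF finite_half_edges[of n d]]
  by (simp add: mult.assoc flip: of_nat_power)

text \<open>Divide \<open>card_siblings_square_le\<close> by \<open>256 * l\<^sup>2\<close> and use
  \<open>(l - 1) * (l - 3) \<le> l\<^sup>2\<close>. Since \<open>nu\<close> is the number of
  siblings over \<open>l\<close>, the mean is at least of order \<open>nu\<close> squared once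
  \<open>D\<^sup>2 / l\<close> is small.\<close>

lemma mean_count_ge: "nu n d * (nu n d - (real D)\<^sup>2 / l) / 256 \<le> mean_count"
proof -
  let ?S = "real (card (siblings H))"
  have "card {x \<in> H. fst x = i} \<le> D" for i
    using degree_le by (simp add: half_edges_at card_cartesian_product)
  from card_siblings_square_le[OF finite_half_edges this]
  have "real (card (siblings H) ^ 2) \<le> real (256 * card (parallel_pairs H) + D\<^sup>2 * card (siblings H))"
    unfolding of_nat_le_iff .
  then have "?S\<^sup>2 - (real D)\<^sup>2 * ?S \<le> 256 * real (card (parallel_pairs H))" by simp
  then have "(?S\<^sup>2 - (real D)\<^sup>2 * ?S) / (256 * l\<^sup>2) \<le> 256 * real (card (parallel_pairs H)) / (256 * l\<^sup>2)"
    by (intro divide_right_mono) auto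
  also have "\<dots> = real (card (parallel_pairs H)) / l\<^sup>2" by simp
  also have "\<dots> \<le> mean_count"
    unfolding mean_count_def using l_ge
    by (intro divide_left_mono) (auto simp: power2_eq_square intro!: mult_mono mult_pos_pos)
  finally show ?thesis using l_ge by (simp add: nu_eq power2_eq_square field_simps)
qed

lemma char_multi_edge_count_approx:
  assumes "0 < mean_multi_edge_count n d"
  shows "norm (char (distr (measure_pmf (config_model n d)) borel
       (\<lambda>G. (real (multi_edge_count n G) - mean_multi_edge_count n d) / sqrt (mean_multi_edge_count n d))) t
     - exp (- (t\<^sup>2) / 2)) \<le> \<bar>t\<bar> * (t\<^sup>2 / (2 * sqrt (mean_multi_edge_count n d)) + \<bar>t\<bar> * (84 * (real D)\<^sup>2 / l))"
proof -
  have pos: "mean_count > 0" using assms by (simp add: mean_multi_edge_count_eq)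
  \<comment> \<open>A positive mean provides a parallel pair, from which
    \<open>defect_nonneg\<close> follows.\<close>
  then have "card (parallel_pairs H) > 0" using l_ge by (auto simp: mean_count_def zero_less_divide_iff)
  then obtain \<alpha> where "\<alpha> \<in> parallel_pairs H" by (auto simp: card_gt_0_iff)
  then have "0 \<le> defect" by (rule defect_nonneg)
  from count_char_approx[OF pos this, of t]
  have "norm (count_char t - exp (- (t\<^sup>2) / 2)) \<le> \<bar>t\<bar> * (t\<^sup>2 / (2 * sqrt mean_count) + \<bar>t\<bar> * defect)" .
  also have "\<dots> \<le> \<bar>t\<bar> * (t\<^sup>2 / (2 * sqrt mean_count) + \<bar>t\<bar> * (84 * (real D)\<^sup>2 / l))"
    using defect_le by (intro mult_left_mono add_left_mono) auto
  finally show ?thesis unfolding char_multi_edge_count unfolding mean_multi_edge_count_eq .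
qed

end

theorem theorem1p8:
  fixes d :: "nat \<Rightarrow> nat \<Rightarrow> nat"
  assumes pos: "\<And>n i. i \<in> {1..n} \<Longrightarrow> d n i > 0"
    and even_sum: "\<And>n. even (\<Sum>i\<in>{1..n}. d n i)"
    and dmax: "(\<lambda>n. real (Max (d n ` {1..n}))) \<in> o(\<lambda>n. sqrt (real n))"
    and nu_lim: "filterlim (\<lambda>n. nu n (d n)) at_top sequentially"
  shows "weak_conv_m
    (\<lambda>n. distr (measure_pmf (config_model n (d n))) borel
       (\<lambda>G. (real (multi_edge_count n G) - mean_multi_edge_count n (d n))
              / sqrt (mean_multi_edge_count n (d n))))
    std_normal_distribution"
proof (rule levy_continuity)
  \<comment> \<open>\<open>D 0\<close> is the unspecified maximum of the empty set; the estimates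
    below concern \<open>n \<ge> 16\<close>.\<close>
  define D where "D n = Max (d n ` {1..n})" for n
  define r where "r n = (real (D n))\<^sup>2 / real n" for n
  define m where "m n = mean_multi_edge_count n (d n)" for n
  let ?M = "\<lambda>n. distr (measure_pmf (config_model n (d n))) borel
       (\<lambda>G. (real (multi_edge_count n G) - mean_multi_edge_count n (d n))
              / sqrt (mean_multi_edge_count n (d n)))"
  show "real_distribution (?M n)" for n
    by (rule prob_space.real_distribution_distr[OF measure_pmf.prob_space_axioms]) simp
  show "real_distribution std_normal_distribution" by (rule real_dist_normal_dist)
  \<comment> \<open>Positive degrees give at least \<open>n\<close> half-edges, which lets the
    hypothesis on the maximal degree control \<open>D\<^sup>2 / l\<close>.\<close>
  have degree_sum: "real n \<le> real (\<Sum>i\<in>{1..n}. d n i)" for n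
  proof -
    have "(\<Sum>i\<in>{1..n}. 1) \<le> (\<Sum>i\<in>{1..n}. d n i)" using pos by (intro sum_mono) (simp add: Suc_leI)
    then show ?thesis unfolding of_nat_le_iff by simp
  qed
  have r_lim: "r \<longlonglongrightarrow> 0"
  proof -
    have "(\<lambda>n. (real (D n) / sqrt (real n))\<^sup>2) \<longlonglongrightarrow> 0\<^sup>2"
      using smalloD_tendsto[OF dmax] unfolding D_def by (rule tendsto_power)
    then show ?thesis by (simp add: r_def[abs_def] power_divide)
  qed
  have config: "config n (d n) (D n)" and ratio_le: "(real (D n))\<^sup>2 / edge_pairs.l (half_edges n (d n)) \<le> r n"
    if "n \<ge> 16" for n
  proof -
    have deg: "(\<Sum>i\<in>{1..n}. d n i) \<ge> 16" using degree_sum[of n] that by linarith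
    show c: "config n (d n) (D n)"
      by unfold_locales (use even_sum deg in \<open>auto simp: D_def\<close>)
    interpret config n "d n" "D n" by (rule c)
    have "l \<ge> real n" using degree_sum[of n] by (simp add: l_eq)
    then show "(real (D n))\<^sup>2 / l \<le> r n" using that unfolding r_def by (intro divide_left_mono) auto
  qed
  \<comment> \<open>By \<open>mean_count_ge\<close> the mean is at least
    \<open>nu * (nu - r) / 256\<close>, and both factors tend to infinity.\<close>
  have m_lim: "filterlim m at_top sequentially"
  proof (rule filterlim_at_top_mono)
    have "filterlim (\<lambda>n. nu n (d n) + - r n) at_top sequentially"
      using filterlim_tendsto_add_at_top[OF tendsto_minus[OF r_lim] nu_lim] by (simp add: add.commute)
    from filterlim_at_top_mult_at_top[OF nu_lim this]
    show "filterlim (\<lambda>n. 1 / 256 * (nu n (d n) * (nu n (d n) + - r n))) at_top sequentially"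
      by (intro filterlim_tendsto_pos_mult_at_top[OF tendsto_const]) auto
    have "\<forall>\<^sub>F n in sequentially. nu n (d n) \<ge> 0" using nu_lim unfolding filterlim_at_top by blast
    then show "\<forall>\<^sub>F n in sequentially. 1 / 256 * (nu n (d n) * (nu n (d n) + - r n)) \<le> m n"
      using eventually_ge_at_top[of 16]
    proof eventually_elim
      case (elim n)
      interpret config n "d n" "D n" using config[OF elim(2)] .
      \<comment> \<open>Multiplying by \<open>nu\<close> preserves the inequality because
        \<open>nu\<close> is eventually nonnegative.\<close>
      have "nu n (d n) * (nu n (d n) + - r n) \<le> nu n (d n) * (nu n (d n) - (real (D n))\<^sup>2 / l)"
        using ratio_le[OF elim(2)] elim(1) by (intro mult_left_mono) auto
      then show ?case using mean_count_ge by (simp add: m_def mean_multi_edge_count_eq)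
    qed
  qed
  \<comment> \<open>By Levy's continuity theorem pointwise convergence suffices. Both error terms
    vanish, the first because \<open>m\<close> tends to infinity and the second because
    \<open>r\<close> tends to 0.\<close>
  show "(\<lambda>n. char (?M n) t) \<longlonglongrightarrow> char std_normal_distribution t" for t
  proof -
    have "filterlim (\<lambda>n. 2 * sqrt (m n)) at_top sequentially"
      by (intro filterlim_tendsto_pos_mult_at_top[OF tendsto_const] filterlim_compose[OF sqrt_at_top m_lim]) simp
    then have "(\<lambda>n. t\<^sup>2 / (2 * sqrt (m n))) \<longlonglongrightarrow> 0"
      by (intro tendsto_divide_0[OF tendsto_const] filterlim_at_top_imp_at_infinity)
    then have lim: "(\<lambda>n. \<bar>t\<bar> * (t\<^sup>2 / (2 * sqrt (m n)) + \<bar>t\<bar> * (84 * r n))) \<longlonglongrightarrow> 0"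
      by (intro tendsto_mult_right_zero tendsto_add_zero r_lim)
    have "\<forall>\<^sub>F n in sequentially. m n > 0" using m_lim unfolding filterlim_at_top_dense by blast
    then have "\<forall>\<^sub>F n in sequentially. norm (char (?M n) t - exp (- (t\<^sup>2) / 2))
        \<le> \<bar>t\<bar> * (t\<^sup>2 / (2 * sqrt (m n)) + \<bar>t\<bar> * (84 * r n))"
      using eventually_ge_at_top[of 16]
    proof eventually_elim
      case (elim n)
      interpret config n "d n" "D n" using config[OF elim(2)] .
      have "norm (char (?M n) t - exp (- (t\<^sup>2) / 2))
          \<le> \<bar>t\<bar> * (t\<^sup>2 / (2 * sqrt (m n)) + \<bar>t\<bar> * (84 * (real (D n))\<^sup>2 / l))"
        using char_multi_edge_count_approx elim(1) unfolding m_def .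
      also have "\<dots> \<le> \<bar>t\<bar> * (t\<^sup>2 / (2 * sqrt (m n)) + \<bar>t\<bar> * (84 * r n))"
        using ratio_le[OF elim(2)] by (intro mult_left_mono add_left_mono) auto
      finally show ?case .
    qed
    from Lim_null_comparison[OF this lim]
    show ?thesis by (simp add: char_std_normal_distribution LIM_zero_iff)
  qed
qed

end
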